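(* Let $\alpha=\frac{3}{16}\left(3\log_2 3-4\right)\approx 0.141$. As $n\to\infty$ over even integers, the number of monotone path systems in the $n$-vertex graph $\mathcal{J}_{\frac n2}$ is $2^{\alpha n^2(1+o(1))}$. In particular, $$|\mathscr{NS}(\mathcal{J}_{\frac n2})|\ge 2^{\alpha n^2(1+o(1))}.$$
   Context: $\mathcal{J}_m$ is the graph whose vertex set is the disjoint union of $\{x_1,\dots,x_m\}$ and $\{y_1,\dots,y_m\}$, in which the only pairs of non-adjacent distinct vertices are $x_i,x_j$ with $1\le i<j\le m$. A consistent path system $\mathcal{P}$ in a graph $G=(V,E)$ is a collection of simple paths in $G$ with exactly one path $P_{u,v}=P_{v,u}$ in $\mathcal{P}$ between any two distinct vertices $u,v$, such that the non-empty intersection of any two paths in $\mathcal{P}$ is either a single vertex or a path in $\mathcal{P}$. It is neighborly if $P_{u,v}$ is the edge $uv$ whenever $uv\in E$. It is strictly metric if there is $w:E\to\mathbb{R}_{>0}$ such that each path in $\mathcal{P}$ is the unique $w$-shortest path in $G$ between its end vertices. $\mathscr{NS}(G)$ denotes the set of all neighborly strictly metric path systems in $G$. A monotone path system in $\mathcal{J}_m$ is a path system in which every adjacent pair is joined by its edge, and for every pair $i\ne j$ in $\{1,\dots,m\}$ there is an index $m_{ij}=m_{ji}\in\{1,\dots,m\}$ with $P_{x_i,x_j}=x_i\,y_{m_{ij}}\,x_j$, such that $m_{ij}\le m_{ik}$ whenever $j\le k$ and $j,k\ne i$. *)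

theory Defs
  imports Complex_Main
begin

text \<open>
  A finite simple graph is given by its vertex set \<open>V\<close> and its edge set \<open>E\<close>, whose members
  are two-element sets \<open>{u, v}\<close>. Paths are given by their vertex sequences.
\<close>

fun path_edges :: "'a list \<Rightarrow> 'a set set" where
  "path_edges (u # v # p) = insert {u, v} (path_edges (v # p))"
| "path_edges _ = {}"

definition simple_path :: "'a set \<Rightarrow> 'a set set \<Rightarrow> 'a list \<Rightarrow> bool" where
  "simple_path V E p \<longleftrightarrow> p \<noteq> [] \<and> distinct p \<and> set p \<subseteq> V \<and> path_edges p \<subseteq> E"

text \<open>
  Paths are undirected, so a collection of paths is represented by the set of all vertex
  sequences traversing its members, each path being listed in both directions. In this way
  distinct collections have distinct representations. The collection has no one-vertex paths.
\<close>

definition path_system :: "'a set \<Rightarrow> 'a set set \<Rightarrow> 'a list set \<Rightarrow> bool" where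
  "path_system V E P \<longleftrightarrow>
     (\<forall>p\<in>P. simple_path V E p \<and> hd p \<noteq> last p \<and> rev p \<in> P) \<and>
     (\<forall>u\<in>V. \<forall>v\<in>V. u \<noteq> v \<longrightarrow> (\<exists>!p. p \<in> P \<and> hd p = u \<and> last p = v))"

definition path_of :: "'a list set \<Rightarrow> 'a \<Rightarrow> 'a \<Rightarrow> 'a list" where
  "path_of P u v = (THE p. p \<in> P \<and> hd p = u \<and> last p = v)"

text \<open>The intersection of two paths is their intersection as subgraphs (vertices and edges).\<close>

definition consistent_path_system :: "'a set \<Rightarrow> 'a set set \<Rightarrow> 'a list set \<Rightarrow> bool" where
  "consistent_path_system V E P \<longleftrightarrow>
     path_system V E P \<and>
     (\<forall>p\<in>P. \<forall>q\<in>P. set p \<inter> set q \<noteq> {} \<longrightarrow>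
        (\<exists>v. set p \<inter> set q = {v}) \<or>
        (\<exists>r\<in>P. set r = set p \<inter> set q \<and> path_edges r = path_edges p \<inter> path_edges q))"

definition neighborly :: "'a set set \<Rightarrow> 'a list set \<Rightarrow> bool" where
  "neighborly E P \<longleftrightarrow> (\<forall>u v. {u, v} \<in> E \<longrightarrow> path_of P u v = [u, v])"

definition strictly_metric :: "'a set \<Rightarrow> 'a set set \<Rightarrow> 'a list set \<Rightarrow> bool" where
  "strictly_metric V E P \<longleftrightarrow>
     (\<exists>w :: 'a set \<Rightarrow> real.
        (\<forall>e\<in>E. w e > 0) \<and>
        (\<forall>p\<in>P. \<forall>q. simple_path V E q \<and> hd q = hd p \<and> last q = last p \<and> q \<noteq> p \<longrightarrow>
           sum w (path_edges p) < sum w (path_edges q)))"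

definition NS :: "'a set \<Rightarrow> 'a set set \<Rightarrow> 'a list set set" where
  "NS V E = {P. consistent_path_system V E P \<and> neighborly E P \<and> strictly_metric V E P}"

datatype jvertex = X nat | Y nat

definition J_verts :: "nat \<Rightarrow> jvertex set" where
  "J_verts m = X ` {1..m} \<union> Y ` {1..m}"

definition J_edges :: "nat \<Rightarrow> jvertex set set" where
  "J_edges m = {{u, v} | u v. u \<in> J_verts m \<and> v \<in> J_verts m \<and> u \<noteq> v \<and>
                  \<not> (\<exists>i j. u = X i \<and> v = X j)}"

definition monotone_path_system :: "nat \<Rightarrow> jvertex list set \<Rightarrow> bool" where
  "monotone_path_system m P \<longleftrightarrow>
     path_system (J_verts m) (J_edges m) P \<and> neighborly (J_edges m) P \<and>
     (\<exists>M :: nat \<Rightarrow> nat \<Rightarrow> nat.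
        (\<forall>i\<in>{1..m}. \<forall>j\<in>{1..m}. i \<noteq> j \<longrightarrow>
           M i j \<in> {1..m} \<and> M i j = M j i \<and> path_of P (X i) (X j) = [X i, Y (M i j), X j]) \<and>
        (\<forall>i\<in>{1..m}. \<forall>j\<in>{1..m}. \<forall>k\<in>{1..m}. j \<le> k \<and> j \<noteq> i \<and> k \<noteq> i \<longrightarrow> M i j \<le> M i k))"

end

theory Submission
  imports Defs "Jordan_Normal_Form.Determinant" "HOL-Analysis.Convex" "HOL-Real_Asymp.Real_Asymp"
begin

text \<open>
  A monotone path system is determined by its matrix \<open>m\<^sub>i\<^sub>j\<close>, a symmetric array (without diagonal)
  with values in \<open>{1..m}\<close> and weakly increasing rows. Its part above the diagonal is a triangle; read
  along its diagonals, with \<open>i\<close> added to the \<open>i\<close>-th entry of each diagonal, it becomes a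
  Gelfand-Tsetlin pattern whose first row is a strictly increasing sequence \<open>l\<close> of length
  \<open>N = m - 1\<close> in \<open>{0, \<dots>, 2 N - 1}\<close>. The number of patterns with first row \<open>l\<close> is the
  determinant \<open>\<Delta>(l) = det (l\<^sub>i choose j)\<close>, because summing over all rows that interlace with \<open>l\<close>
  telescopes in each row of the determinant (\<open>gt_count_eq_det\<close>). Hence the number of systems is
  \<open>S = \<Sum>\<^sub>l \<Delta>(l)\<close>.

  This sum is hard, but \<open>\<Sum>\<^sub>l \<Delta>(l)\<^sup>2\<close> is easy: by Andreief's identity it is the Gram determinant of the
  functions \<open>x choose j\<close>, \<open>j < N\<close>, on \<open>{0, \<dots>, 2 N - 1}\<close>, and the discrete Chebyshev polynomials
  triangularize that Gram matrix. There are at most \<open>(2 N)\<^sup>N\<close> sequences \<open>l\<close>, so the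
  Cauchy-Schwarz inequality makes \<open>S\<^sup>2\<close> and the Gram determinant agree up to a factor
  \<open>exp (O (N ln N))\<close>, which is negligible against \<open>exp (c N\<^sup>2)\<close>. The Gram determinant \<open>D\<^sub>N\<close> is the product
  \<open>sf (3 N) sf (N)\<^sup>3 / sf (2 N)\<^sup>3\<close> of superfactorials \<open>sf k = \<Prod>\<^bsub>j<k\<^esub> j!\<close>. The second difference
  of its logarithm is the logarithm of a rational function of \<open>N\<close> with limit \<open>3\<^sup>9 / 2\<^sup>1\<^sup>2\<close>, so two applications of the
  Stolz-Cesaro theorem give \<open>ln D\<^sub>N / N\<^sup>2 \<rightarrow> (9 ln 3 - 12 ln 2) / 2\<close>. Half of this limit is
  the growth rate of \<open>ln S\<close>; with \<open>n = 2 m\<close> vertices it is \<open>\<alpha>\<close> in base \<open>2\<close>.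

  For the lower bound on the neighborly strictly metric systems it remains to see that every monotone system is one of them. For each
  threshold \<open>k\<close> the pairs \<open>i < j\<close> with \<open>m\<^sub>i\<^sub>j \<le> k\<close> form a down-set, hence a threshold graph: there are numbers
  \<open>d\<^sub>k(i)\<close> such that \<open>d\<^sub>k(i) + d\<^sub>k(j)\<close> is positive exactly for these pairs and negative for the
  others (\<open>threshold_weights\<close>). Giving the edge \<open>x\<^sub>i y\<^sub>k\<close> the weight \<open>C + \<Sum>\<^bsub>r<k\<^esub> d\<^sub>r(i)\<close> makes
  the length of \<open>x\<^sub>i y\<^sub>k x\<^sub>j\<close> decrease in \<open>k\<close> up to \<open>k = m\<^sub>i\<^sub>j\<close> and increase from there on, and a large
  constant \<open>C\<close> rules out paths with more edges.
\<close>

section \<open>Sums of determinants and Gelfand-Tsetlin patterns\<close>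

text \<open>
  Multilinearity in all rows at once. It is what lets a determinant absorb a sum over a product
  set of rows, both for interlacing rows and in Andreief's identity.
\<close>

lemma det_rows_sum:
  fixes g :: "nat \<Rightarrow> 'b \<Rightarrow> nat \<Rightarrow> 'a :: comm_ring_1"
  assumes "\<And>i. i < n \<Longrightarrow> finite (B i)"
  shows "det (mat n n (\<lambda>(i, j). \<Sum>x\<in>B i. g i x j)) =
         (\<Sum>f\<in>PiE {..<n} B. det (mat n n (\<lambda>(i, j). g i (f i) j)))"
proof -
  have eq: "det (mat n n (\<lambda>(i, j). h i j)) =
      (\<Sum>p | p permutes {..<n}. signof p * (\<Prod>i<n. h i (p i)))" for h :: "nat \<Rightarrow> nat \<Rightarrow> 'a"
  proof -
    have "(\<Prod>i<n. mat n n (\<lambda>(i, j). h i j) $$ (i, p i)) = (\<Prod>i<n. h i (p i))"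
      if "p permutes {..<n}" for p
      using permutes_in_image[OF that] by (intro prod.cong) auto
    then show ?thesis by (simp add: det_def atLeast0LessThan)
  qed
  have "(\<Prod>i<n. \<Sum>x\<in>B i. g i x (p i)) = (\<Sum>f\<in>PiE {..<n} B. \<Prod>i<n. g i (f i) (p i))" for p
    by (rule prod_sum_PiE) (auto simp: assms)
  then show ?thesis
    unfolding eq by (subst sum.swap) (simp add: sum_distrib_left)
qed

lemma det_mat_permutes:
  assumes "p permutes {..<n}"
  shows "det (mat n n (\<lambda>(i, j). g (p i) j)) = signof p * det (mat n n (\<lambda>(i, j). g i j :: 'a :: comm_ring_1))"
proof -
  have "mat n n (\<lambda>(i, j). g (p i) j) = mat n n (\<lambda>(i, j). mat n n (\<lambda>(i, j). g i j) $$ (p i, j))"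
    using permutes_in_image[OF assms] by (intro eq_matI) auto
  then show ?thesis
    using det_permute_rows[of "mat n n (\<lambda>(i, j). g i j)" n p] assms
    by (simp add: atLeast0LessThan)
qed

text \<open>
  Expanding every row of the Gram matrix gives \<open>\<Sum>\<^sub>f (\<Prod>\<^sub>i g (f i) i) det (g (f i) j)\<close>. The substitution
  \<open>f \<mapsto> f \<circ> p\<close> leaves the sum unchanged and contributes the sign of the permutation \<open>p\<close>;
  summing over all \<open>p\<close> turns the products into a second determinant.
\<close>

lemma andreief:
  fixes g :: "'b \<Rightarrow> nat \<Rightarrow> 'a :: comm_ring_1"
  assumes "finite B"
  shows "(\<Sum>f\<in>PiE {..<n} (\<lambda>_. B). (det (mat n n (\<lambda>(i, j). g (f i) j)))\<^sup>2) =
         of_nat (fact n) * det (mat n n (\<lambda>(i, j). \<Sum>x\<in>B. g x i * g x j))"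
proof -
  let ?F = "PiE {..<n} (\<lambda>_. B)"
  let ?D = "\<lambda>f. det (mat n n (\<lambda>(i, j). g (f i) j))"
  let ?G = "det (mat n n (\<lambda>(i, j). \<Sum>x\<in>B. g x i * g x j))"
  have scale: "det (mat n n (\<lambda>(i, j). c i * h i j)) = (\<Prod>i<n. c i) * det (mat n n (\<lambda>(i, j). h i j))"
    for c :: "nat \<Rightarrow> 'a" and h
    by (auto simp: det_def atLeast0LessThan sum_distrib_left prod.distrib permutes_in_image
             intro!: sum.cong)
  have G: "?G = (\<Sum>f\<in>?F. (\<Prod>i<n. g (f i) i) * ?D f)"
    by (subst det_rows_sum) (simp_all add: assms scale)
  have Gp: "?G = (\<Sum>f\<in>?F. signof p * (\<Prod>i<n. g (f (p i)) i) * ?D f)"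
    if p: "p permutes {..<n}" for p
  proof -
    have bij: "bij_betw (\<lambda>f. f \<circ> p) ?F ?F"
    proof (rule bij_betwI[where g = "\<lambda>f. f \<circ> inv_into UNIV p"])
      have "inv_into UNIV p permutes {..<n}" using p by (rule permutes_inv)
      then show "(\<lambda>f. f \<circ> inv_into UNIV p) \<in> ?F \<rightarrow> ?F"
        by (auto simp: PiE_iff extensional_def permutes_in_image permutes_def)
      show "(\<lambda>f. f \<circ> p) \<in> ?F \<rightarrow> ?F"
        using p by (auto simp: PiE_iff extensional_def permutes_in_image permutes_def)
    qed (use p in \<open>auto simp: fun_eq_iff permutes_inverses\<close>)
    have "?G = (\<Sum>f\<in>?F. (\<Prod>i<n. g (f (p i)) i) * ?D (f \<circ> p))"
      unfolding G using sum.reindex_bij_betw[OF bij, of "\<lambda>f. (\<Prod>i<n. g (f i) i) * ?D f"] by simp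
    also have "\<dots> = (\<Sum>f\<in>?F. (\<Prod>i<n. g (f (p i)) i) * (signof p * ?D f))"
      using det_mat_permutes[OF p, of "\<lambda>i j. g (f i) j" for f] by simp
    finally show ?thesis by (simp add: ac_simps)
  qed
  have "(\<Sum>f\<in>?F. (?D f)\<^sup>2) = (\<Sum>f\<in>?F. \<Sum>p | p permutes {..<n}. signof p * (\<Prod>i<n. g (f (p i)) i) * ?D f)"
  proof (intro sum.cong refl)
    fix f
    have "?D f = (\<Sum>p | p permutes {..<n}. signof p * (\<Prod>i<n. mat n n (\<lambda>(i, j). g (f i) j) $$ (p i, i)))"
      by (subst mat_det_left_def[of _ n]) (auto simp: atLeast0LessThan)
    also have "\<dots> = (\<Sum>p | p permutes {..<n}. signof p * (\<Prod>i<n. g (f (p i)) i))"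
    proof (intro sum.cong refl)
      fix p assume "p \<in> {p. p permutes {..<n}}"
      then have "p i < n" if "i < n" for i using permutes_in_image[of p "{..<n}" i] that by auto
      then show "signof p * (\<Prod>i<n. mat n n (\<lambda>(i, j). g (f i) j) $$ (p i, i)) =
        signof p * (\<Prod>i<n. g (f (p i)) i)"
        by simp
    qed
    finally show "(?D f)\<^sup>2 = (\<Sum>p | p permutes {..<n}. signof p * (\<Prod>i<n. g (f (p i)) i) * ?D f)"
      by (simp add: power2_eq_square sum_distrib_right)
  qed
  also have "\<dots> = (\<Sum>p | p permutes {..<n}. ?G)"
    by (subst sum.swap) (simp add: Gp)
  also have "\<dots> = of_nat (fact n) * ?G"
    by (simp add: card_permutations)
  finally show ?thesis .
qed

text \<open>
  The number of Gelfand-Tsetlin patterns with a given first row \<open>l\<^sub>0, \<dots>, l\<^sub>n\<close>. Rows are shifted to be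
  strictly increasing, which turns interlacing into \<open>l\<^sub>i \<le> \<mu>\<^sub>i < l\<^sub>i\<^sub>+\<^sub>1\<close>: the next row then ranges
  over a product of intervals, and it is automatically strictly increasing.
\<close>

fun gt_count :: "nat \<Rightarrow> (nat \<Rightarrow> nat) \<Rightarrow> nat" where
  "gt_count 0 l = 1"
| "gt_count (Suc n) l = (\<Sum>\<mu>\<in>PiE {..n} (\<lambda>i. {l i..<l (Suc i)}). gt_count n \<mu>)"

definition binomial_det :: "nat \<Rightarrow> (nat \<Rightarrow> nat) \<Rightarrow> real" where
  "binomial_det n l = det (mat n n (\<lambda>(i, j). real (l i choose j)))"

text \<open>
  Subtracting from each row the one above it reduces the first column, which consists of ones, to
  a unit vector. The row operation is performed by a unipotent bidiagonal matrix.
\<close>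

lemma binomial_det_Suc:
  "binomial_det (Suc n) l =
   det (mat n n (\<lambda>(i, j). real (l (Suc i) choose Suc j) - real (l i choose Suc j)))"
proof -
  let ?A = "mat (Suc n) (Suc n) (\<lambda>(i, j). real (l i choose j))"
  define E :: "real mat" where
    "E = mat (Suc n) (Suc n) (\<lambda>(i, j). if j = i then 1 else if Suc j = i then - 1 else 0)"
  define R where "R = mat (Suc n) (Suc n)
    (\<lambda>(i, j). if i = 0 then real (l 0 choose j) else real (l i choose j) - real (l (i - 1) choose j))"
  have [simp]: "E \<in> carrier_mat (Suc n) (Suc n)" "R \<in> carrier_mat (Suc n) (Suc n)"
    by (simp_all add: E_def R_def)
  have "det E = 1"
    by (subst det_lower_triangular[where n = "Suc n"])
       (auto simp: E_def prod_list_diag_prod)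
  have ER: "E * ?A = R"
  proof (intro eq_matI)
    fix i j assume "i < dim_row R" "j < dim_col R"
    then have ij: "i < Suc n" "j < Suc n" by (auto simp: R_def)
    have "(E * ?A) $$ (i, j) = (\<Sum>k<Suc n. (if k = i then 1 else if Suc k = i then - 1 else 0) * real (l k choose j))"
      using ij by (simp add: E_def scalar_prod_def atLeast0LessThan)
    also have "\<dots> = (\<Sum>k<Suc n. (if k = i then real (l k choose j) else 0) +
                     (if Suc k = i then - real (l k choose j) else 0))"
      by (intro sum.cong) auto
    also have "\<dots> = real (l i choose j) + (\<Sum>k<Suc n. if Suc k = i then - real (l k choose j) else 0)"
      using ij by (simp add: sum.distrib del: sum.lessThan_Suc)
    also have "(\<Sum>k<Suc n. if Suc k = i then - real (l k choose j) else 0) =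
               (if i = 0 then 0 else - real (l (i - 1) choose j))"
    proof (cases i)
      case (Suc i')
      then have "i' \<in> {..<Suc n}" using ij by auto
      then show ?thesis using Suc by (simp del: sum.lessThan_Suc lessThan_iff)
    qed auto
    finally show "(E * ?A) $$ (i, j) = R $$ (i, j)"
      using ij by (auto simp: R_def)
  qed (auto simp: E_def R_def)
  have "binomial_det (Suc n) l = det (E * ?A)"
    by (subst det_mult[where n = "Suc n"]) (auto simp: \<open>det E = 1\<close> binomial_det_def)
  also have "\<dots> = (\<Sum>i<Suc n. R $$ (i, 0) * cofactor R i 0)"
    unfolding ER by (rule laplace_expansion_column) auto
  also have "\<dots> = (\<Sum>i<Suc n. if i = 0 then cofactor R 0 0 else 0)"
    by (intro sum.cong) (auto simp: R_def)
  also have "\<dots> = det (mat_delete R 0 0)"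
    by (simp add: cofactor_def del: sum.lessThan_Suc)
  also have "mat_delete R 0 0 = mat n n (\<lambda>(i, j). real (l (Suc i) choose Suc j) - real (l i choose Suc j))"
    by (intro eq_matI) (auto simp: mat_delete_def R_def)
  finally show ?thesis .
qed

lemma sum_choose_interval:
  assumes "a \<le> b"
  shows "(\<Sum>x=a..<b. real (x choose j)) = real (b choose Suc j) - real (a choose Suc j)"
  using assms by (induction b rule: dec_induct) auto

text \<open>
  By the hockey-stick identity the differences of binomial coefficients that remain after the row operation
  are sums over the intervals \<open>{l\<^sub>i..<l\<^sub>i\<^sub>+\<^sub>1}\<close>. Multilinearity pulls these sums out, and what is left is the
  recursion that defines the number of patterns.
\<close>

lemma gt_count_eq_det:
  assumes "\<And>i. i < n \<Longrightarrow> l i \<le> l (Suc i)"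
  shows "real (gt_count n l) = binomial_det (Suc n) l"
  using assms
proof (induction n arbitrary: l)
  case 0
  show ?case by (simp add: binomial_det_def det_single[of _ ] mat_det_left_def[of _ 1])
next
  case (Suc n)
  have "binomial_det (Suc (Suc n)) l =
    det (mat (Suc n) (Suc n) (\<lambda>(i, j). \<Sum>x\<in>{l i..<l (Suc i)}. real (x choose j)))"
    unfolding binomial_det_Suc using Suc.prems
    by (intro arg_cong[where f = det] eq_matI) (auto simp: sum_choose_interval)
  also have "\<dots> = (\<Sum>\<mu>\<in>PiE {..n} (\<lambda>i. {l i..<l (Suc i)}). binomial_det (Suc n) \<mu>)"
    by (subst det_rows_sum) (auto simp: binomial_det_def lessThan_Suc_atMost)
  also have "\<dots> = (\<Sum>\<mu>\<in>PiE {..n} (\<lambda>i. {l i..<l (Suc i)}). real (gt_count n \<mu>))"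
  proof (intro sum.cong refl Suc.IH[symmetric])
    fix \<mu> i assume "\<mu> \<in> PiE {..n} (\<lambda>i. {l i..<l (Suc i)})" "i < n"
    then have "\<mu> i < l (Suc i)" "l (Suc i) \<le> \<mu> (Suc i)"
      by (fastforce simp: PiE_iff)+
    then show "\<mu> i \<le> \<mu> (Suc i)" by linarith
  qed
  finally show ?case by simp
qed

section \<open>Finite differences and discrete Chebyshev polynomials\<close>

definition fdiff :: "(nat \<Rightarrow> real) \<Rightarrow> nat \<Rightarrow> real" where
  "fdiff f x = f (Suc x) - f x"

lemma fdiff_pow_Suc: "(fdiff ^^ Suc n) f = (fdiff ^^ n) (fdiff f)"
  by (simp add: funpow_swap1)

lemma fdiff_pow_add: "(fdiff ^^ n) (\<lambda>x. f x + g x) = (\<lambda>x. (fdiff ^^ n) f x + (fdiff ^^ n) g x)"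
  by (induction n) (auto simp: fdiff_def fun_eq_iff)

lemma fdiff_pow_zero: "(fdiff ^^ n) (\<lambda>x. 0) = (\<lambda>x. 0)"
  by (induction n) (auto simp: fdiff_def fun_eq_iff)

text \<open>
  The vanishing conditions are those under which all boundary terms disappear, since they only
  involve the values of \<open>f\<close> at the first \<open>n\<close> points from \<open>0\<close> and from \<open>L\<close> on.
\<close>

lemma summation_by_parts:
  assumes "\<And>i. i < n \<Longrightarrow> f i = 0" "\<And>i. i < n \<Longrightarrow> f (L + i) = 0"
  shows "(\<Sum>x<L. q x * (fdiff ^^ n) f x) = (- 1) ^ n * (\<Sum>x<L. (fdiff ^^ n) q x * f (x + n))"
  using assms
proof (induction n arbitrary: f)
  case (Suc n)
  have parts: "(\<Sum>x<M. u x * fdiff f (x + n)) + (\<Sum>x<M. fdiff u x * f (Suc (x + n))) =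
      u M * f (M + n) - u 0 * f n" for u M
    by (induction M) (auto simp: fdiff_def algebra_simps)
  have "(\<Sum>x<L. q x * (fdiff ^^ Suc n) f x) = (- 1) ^ n * (\<Sum>x<L. (fdiff ^^ n) q x * fdiff f (x + n))"
    unfolding fdiff_pow_Suc using Suc.prems(1) Suc.prems(2)
    by (intro Suc.IH) (auto simp: fdiff_def simp flip: add_Suc_right)
  also have "(\<Sum>x<L. (fdiff ^^ n) q x * fdiff f (x + n)) =
             - (\<Sum>x<L. fdiff ((fdiff ^^ n) q) x * f (Suc (x + n)))"
    using parts[where u = "(fdiff ^^ n) q" and M = L] Suc.prems by simp
  finally show ?case by simp
qed simp

lemma fdiff_gbinomial: "fdiff (\<lambda>x. (real x + s) gchoose Suc k) = (\<lambda>x. (real x + s) gchoose k)"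
  using gbinomial_Suc_Suc[of "real x + s" k for x] by (auto simp: fdiff_def fun_eq_iff add_ac)

lemma fdiff_binomial: "fdiff (\<lambda>x. real (x choose Suc k)) = (\<lambda>x. real (x choose k))"
  by (auto simp: fdiff_def fun_eq_iff)

lemma fdiff_pow_binomial:
  "(fdiff ^^ n) (\<lambda>x. real (x choose j)) = (\<lambda>x. if n \<le> j then real (x choose (j - n)) else 0)"
proof (induction n arbitrary: j)
  case (Suc n)
  have "fdiff (\<lambda>x. real (x choose 0)) = (\<lambda>x. 0)" by (auto simp: fdiff_def)
  then show ?case unfolding fdiff_pow_Suc using Suc
    by (cases j) (auto simp: fdiff_binomial fdiff_pow_zero simp del: binomial_n_0)
qed simp

text \<open>
  The product has degree \<open>a + b\<close>, so its top difference is constant. The discrete Leibniz rule turns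
  the claim into Pascal's rule; it also shifts the argument of one factor, which is why an arbitrary shift \<open>s\<close> is allowed.
\<close>

lemma fdiff_pow_binomial_product:
  "(fdiff ^^ (a + b)) (\<lambda>x. real (x choose a) * ((real x + s) gchoose b)) = (\<lambda>x. real ((a + b) choose a))"
proof (induction "a + b" arbitrary: a b s)
  case (Suc n)
  show ?case
  proof (cases a)
    case [simp]: 0
    have "(fdiff ^^ b) (\<lambda>x. (real x + s) gchoose b) = (\<lambda>x. 1)" for b
      by (induction b) (simp_all add: fdiff_pow_Suc fdiff_gbinomial del: funpow.simps)
    then show ?thesis by simp
  next
    case [simp]: (Suc a')
    show ?thesis
    proof (cases b)
      case [simp]: 0
      show ?thesis using fdiff_pow_binomial[of a a] by simp
    next
      case [simp]: (Suc b')
      have "(fdiff ^^ (a + b)) (\<lambda>x. real (x choose a) * ((real x + s) gchoose b)) =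
            (fdiff ^^ n) (\<lambda>x. real (x choose a') * ((real x + (s + 1)) gchoose b) +
                              real (x choose a) * ((real x + s) gchoose b'))"
      proof -
        have "fdiff (\<lambda>x. real (x choose a) * ((real x + s) gchoose b)) =
            (\<lambda>x. real (x choose a') * ((real x + (s + 1)) gchoose b) +
                              real (x choose a) * ((real x + s) gchoose b'))"
          using fun_cong[OF fdiff_gbinomial[of s b']]
          by (auto simp: fdiff_def fun_eq_iff algebra_simps)
        moreover have "a + b = Suc n" using Suc.hyps by simp
        ultimately show ?thesis by (simp only: fdiff_pow_Suc)
      qed
      also have "\<dots> = (\<lambda>x. real ((a' + b) choose a') + real ((a + b') choose a))"
        using Suc.hyps(1)[of a' b "s + 1"] Suc.hyps(1)[of a b' s] Suc.hyps(2)
        unfolding fdiff_pow_add by simp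
      finally show ?thesis by simp
    qed
  qed
qed simp

text \<open>
  Newton's forward difference formula, used to write the discrete Chebyshev polynomials as
  combinations of the functions \<open>x choose i\<close>.
\<close>

lemma newton_forward:
  assumes "\<And>i. i \<ge> N \<Longrightarrow> (fdiff ^^ i) f 0 = 0"
  shows "f x = (\<Sum>i<N. real (x choose i) * (fdiff ^^ i) f 0)"
  using assms
proof (induction x arbitrary: f)
  case 0
  have "(\<Sum>i<N. real (0 choose i) * (fdiff ^^ i) f 0) = (\<Sum>i<N. if i = 0 then f 0 else 0)"
    by (intro sum.cong) auto
  also have "\<dots> = f 0" using 0[of 0] by auto
  finally show ?case by simp
next
  case (Suc x)
  have "f (Suc x) = f x + fdiff f x" by (simp add: fdiff_def)
  also have "f x = (\<Sum>i<N. real (x choose i) * (fdiff ^^ i) f 0)"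
    using Suc.prems by (rule Suc.IH)
  also have "fdiff f x = (\<Sum>i<N. real (x choose i) * (fdiff ^^ Suc i) f 0)"
    unfolding fdiff_pow_Suc using Suc.prems
    by (intro Suc.IH) (simp flip: fdiff_pow_Suc del: funpow.simps)
  also have "(\<Sum>i<N. real (x choose i) * (fdiff ^^ i) f 0) + \<dots> =
             (\<Sum>i<N. real (Suc x choose i) * (fdiff ^^ i) f 0)"
  proof (cases N)
    case [simp]: (Suc M)
    have "(fdiff ^^ Suc M) f 0 = 0" using Suc.prems[of "Suc M"] by simp
    then have "(\<Sum>i<N. real (x choose i) * (fdiff ^^ Suc i) f 0) =
               (\<Sum>i<M. real (x choose i) * (fdiff ^^ Suc i) f 0)" by simp
    then show ?thesis
      by (simp add: sum.lessThan_Suc_shift sum.distrib algebra_simps del: sum.lessThan_Suc funpow.simps)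
  qed simp
  finally show ?case .
qed

text \<open>
  A form of Vandermonde's convolution. It evaluates the inner product of the \<open>n\<close>-th discrete
  Chebyshev polynomial with \<open>x choose n\<close>.
\<close>

lemma vandermonde_shifted:
  "(\<Sum>x<L. ((x + n) choose n) * ((L - 1 - x) choose b)) = (L + n) choose (n + b + 1)"
proof (induction L arbitrary: b)
  case (Suc L)
  show ?case
  proof (cases b)
    case 0
    have "(\<Sum>x<K. (x + n) choose n) = (K + n) choose (n + 1)" for K
      by (induction K) auto
    then show ?thesis using 0 by simp
  next
    case [simp]: (Suc b')
    have "(\<Sum>x<Suc L. ((x + n) choose n) * ((Suc L - 1 - x) choose b)) =
          (\<Sum>x<L. ((x + n) choose n) * (((L - 1 - x) choose b') + ((L - 1 - x) choose b)))"
    proof -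
      have "(L - x) choose b = ((L - 1 - x) choose b') + ((L - 1 - x) choose b)" if "x < L" for x
      proof -
        have "L - x = Suc (L - 1 - x)" using that by simp
        then show ?thesis by simp
      qed
      then show ?thesis by simp
    qed
    also have "\<dots> = ((L + n) choose (n + b' + 1)) + ((L + n) choose (n + b + 1))"
      using Suc.IH[of b'] Suc.IH[of b] by (simp add: sum.distrib distrib_left)
    finally show ?thesis by simp
  qed
qed simp

text \<open>
  Rodrigues' formula: the \<open>n\<close>-th difference of this function is, up to normalization, the \<open>n\<close>-th discrete
  Chebyshev polynomial on \<open>{0, \<dots>, L - 1}\<close>. The function vanishes at the points
  \<open>0, \<dots>, n - 1\<close> and \<open>L, \<dots>, L + n - 1\<close>, exactly as summation by parts needs.
\<close>

definition chebyshev_source :: "nat \<Rightarrow> nat \<Rightarrow> nat \<Rightarrow> real" where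
  "chebyshev_source L n x = real (x choose n) * ((real x - real L) gchoose n)"

lemma chebyshev_source_top: "(fdiff ^^ (n + n)) (chebyshev_source L n) = (\<lambda>x. real ((2 * n) choose n))"
  using fdiff_pow_binomial_product[of n n "- real L"] by (simp add: chebyshev_source_def[abs_def] mult_2)

lemma chebyshev_source_above:
  assumes "i > n"
  shows "(fdiff ^^ (n + i)) (chebyshev_source L n) = (\<lambda>x. 0)"
proof -
  have "fdiff (\<lambda>x. c) = (\<lambda>x. 0)" for c by (auto simp: fdiff_def)
  then have "(fdiff ^^ Suc (n + n)) (chebyshev_source L n) = (\<lambda>x. 0)"
    by (simp add: chebyshev_source_top)
  moreover have "n + i = (i - Suc n) + Suc (n + n)" using assms by simp
  ultimately show ?thesis by (simp only: funpow_add o_apply fdiff_pow_zero)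
qed

text \<open>
  Summation by parts moves all \<open>n\<close> differences to \<open>x choose j\<close>, which they annihilate for \<open>j < n\<close> and turn
  into \<open>1\<close> for \<open>j = n\<close>.
\<close>

lemma chebyshev_orthogonal:
  assumes "j \<le> n"
  shows "(\<Sum>x<L. real (x choose j) * (fdiff ^^ n) (chebyshev_source L n) x) =
         (if j = n then real ((L + n) choose (2 * n + 1)) else 0)"
proof -
  have "chebyshev_source L n (L + i) = 0" if "i < n" for i
    using that by (simp add: chebyshev_source_def flip: binomial_gbinomial)
  then have eq: "(\<Sum>x<L. real (x choose j) * (fdiff ^^ n) (chebyshev_source L n) x) =
      (- 1) ^ n * (\<Sum>x<L. (if n \<le> j then real (x choose (j - n)) else 0) * chebyshev_source L n (x + n))"
    by (subst summation_by_parts) (auto simp: chebyshev_source_def fdiff_pow_binomial)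
  show ?thesis
  proof (cases "j = n")
    case True
    have "chebyshev_source L n (x + n) = (- 1) ^ n * real (((x + n) choose n) * ((L - 1 - x) choose n))"
      if "x < L" for x
    proof -
      have "real n - (real (x + n) - real L) - 1 = real (L - 1 - x)" using that by simp
      then have "(real (x + n) - real L) gchoose n = (- 1) ^ n * real ((L - 1 - x) choose n)"
        by (subst gbinomial_negated_upper) (simp add: binomial_gbinomial)
      then show ?thesis by (simp add: chebyshev_source_def)
    qed
    moreover have "(\<Sum>x<L. real (((x + n) choose n) * ((L - 1 - x) choose n))) =
        real ((L + n) choose (2 * n + 1))"
      unfolding of_nat_sum[symmetric] vandermonde_shifted by (simp add: mult_2)
    moreover have "(- 1 :: real) ^ n * (- 1) ^ n = 1" by (simp flip: power_mult_distrib)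
    ultimately show ?thesis unfolding eq using True
      by (simp add: sum_distrib_left mult.assoc[symmetric])
  qed (use assms eq in auto)
qed

definition gram_binomial :: "nat \<Rightarrow> nat \<Rightarrow> real mat" where
  "gram_binomial L N = mat N N (\<lambda>(i, j). \<Sum>x<L. real (x choose i) * real (x choose j))"

text \<open>
  The matrix \<open>C\<close> of the coefficients of the discrete Chebyshev polynomials in the basis \<open>x choose i\<close> is lower
  triangular with diagonal entries \<open>2 n choose n\<close>. By orthogonality its product with the Gram matrix is upper triangular.
  Comparing the determinants gives the product formula.
\<close>

lemma det_gram_binomial:
  "det (gram_binomial L N) * (\<Prod>n<N. real ((2 * n) choose n)) = (\<Prod>n<N. real ((L + n) choose (2 * n + 1)))"
proof -
  define C where "C = mat N N (\<lambda>(n, i). (fdiff ^^ (n + i)) (chebyshev_source L n) 0)"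
  have carr [simp]: "C \<in> carrier_mat N N" "gram_binomial L N \<in> carrier_mat N N"
    by (simp_all add: C_def gram_binomial_def)
  have entry: "(C * gram_binomial L N) $$ (n, j) =
      (\<Sum>x<L. real (x choose j) * (fdiff ^^ n) (chebyshev_source L n) x)" if "n < N" "j < N" for n j
  proof -
    have newton: "(fdiff ^^ n) (chebyshev_source L n) x =
        (\<Sum>i<N. real (x choose i) * (fdiff ^^ (n + i)) (chebyshev_source L n) 0)" for x
    proof -
      have "(fdiff ^^ i) ((fdiff ^^ n) (chebyshev_source L n)) 0 = (fdiff ^^ (n + i)) (chebyshev_source L n) 0" for i
        by (simp add: funpow_add add.commute)
      then show ?thesis using that
        by (subst newton_forward[where N = N]) (auto simp: chebyshev_source_above)
    qed
    have "(C * gram_binomial L N) $$ (n, j) = (\<Sum>i<N. (fdiff ^^ (n + i)) (chebyshev_source L n) 0 *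
            (\<Sum>x<L. real (x choose i) * real (x choose j)))"
      using that by (simp add: C_def gram_binomial_def scalar_prod_def atLeast0LessThan)
    also have "\<dots> = (\<Sum>x<L. real (x choose j) * (fdiff ^^ n) (chebyshev_source L n) x)"
      unfolding newton sum_distrib_left by (subst sum.swap) (simp add: ac_simps)
    finally show ?thesis .
  qed
  have "det C = (\<Prod>n<N. real ((2 * n) choose n))"
    by (subst det_lower_triangular[where n = N])
       (auto simp: prod_list_diag_prod C_def chebyshev_source_above chebyshev_source_top atLeast0LessThan)
  moreover have "det (C * gram_binomial L N) = (\<Prod>n<N. real ((L + n) choose (2 * n + 1)))"
  proof (subst det_upper_triangular[where n = N])
    show "upper_triangular (C * gram_binomial L N)"
      using carr by (intro upper_triangularI) (auto simp: entry chebyshev_orthogonal carrier_matD[OF carr(1)] simp del: index_mult_mat(1))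
    show "prod_list (diag_mat (C * gram_binomial L N)) = (\<Prod>n<N. real ((L + n) choose (2 * n + 1)))"
      using carr by (auto simp: prod_list_diag_prod entry chebyshev_orthogonal atLeast0LessThan carrier_matD[OF carr(1)]
                          simp del: index_mult_mat(1) intro!: prod.cong)
  qed (rule mult_carrier_mat[OF carr])
  ultimately show ?thesis by (simp add: det_mult[OF carr] mult.commute)
qed

section \<open>Counting patterns up to subexponential factors\<close>

definition strict_rows :: "nat \<Rightarrow> nat \<Rightarrow> (nat \<Rightarrow> nat) set" where
  "strict_rows n L = {l \<in> PiE {..n} (\<lambda>_. {..<L}). \<forall>i<n. l i < l (Suc i)}"

text \<open>
  All patterns whose shifted first row lies below \<open>L\<close>. The parameter \<open>n\<close> is the last index of the
  first row, so this row has \<open>Suc n\<close> entries.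
\<close>

definition gt_total :: "nat \<Rightarrow> nat \<Rightarrow> nat" where
  "gt_total n L = (\<Sum>l\<in>strict_rows n L. gt_count n l)"

lemma finite_strict_rows: "finite (strict_rows n L)"
  unfolding strict_rows_def by (rule finite_subset[of _ "PiE {..n} (\<lambda>_. {..<L})"]) (auto intro: finite_PiE)

lemma binomial_det_strict_row:
  assumes "l \<in> strict_rows n L"
  shows "binomial_det (Suc n) l = real (gt_count n l)"
  using assms by (subst gt_count_eq_det) (auto simp: strict_rows_def less_imp_le)

lemma sum_binomial_det_squares:
  "(\<Sum>f\<in>PiE {..n} (\<lambda>_. {..<L}). (binomial_det (Suc n) f)\<^sup>2) = fact (Suc n) * det (gram_binomial L (Suc n))"
  using andreief[of "{..<L}" "Suc n" "\<lambda>x j. real (x choose j)"]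
  by (simp add: binomial_det_def gram_binomial_def lessThan_Suc_atMost algebra_simps)

lemma card_rows: "card (PiE {..n} (\<lambda>_. {..<L::nat})) = L ^ Suc n"
  by (simp add: card_PiE)

text \<open>
  Cauchy-Schwarz, followed by extending the sum of squares from increasing rows to all rows.
\<close>

lemma gt_total_square_le:
  "(real (gt_total n L))\<^sup>2 \<le> real L ^ Suc n * (fact (Suc n) * det (gram_binomial L (Suc n)))"
proof -
  let ?F = "PiE {..n} (\<lambda>_. {..<L})"
  have sub: "strict_rows n L \<subseteq> ?F" by (auto simp: strict_rows_def)
  have fin: "finite ?F" by (auto intro: finite_PiE)
  have "(real (gt_total n L))\<^sup>2 = (\<Sum>l\<in>strict_rows n L. binomial_det (Suc n) l)\<^sup>2"
    by (simp add: gt_total_def binomial_det_strict_row)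
  also have "\<dots> \<le> (\<Sum>l\<in>strict_rows n L. (binomial_det (Suc n) l)\<^sup>2) * real (card (strict_rows n L))"
    by (rule sum_squared_le_sum_of_squares)
  also have "\<dots> \<le> (\<Sum>f\<in>?F. (binomial_det (Suc n) f)\<^sup>2) * real (L ^ Suc n)"
  proof (rule mult_mono)
    show "real (card (strict_rows n L)) \<le> real (L ^ Suc n)"
      using card_mono[OF fin sub] by (simp only: card_rows of_nat_le_iff)
    show "(\<Sum>l\<in>strict_rows n L. (binomial_det (Suc n) l)\<^sup>2) \<le> (\<Sum>f\<in>?F. (binomial_det (Suc n) f)\<^sup>2)"
      by (rule sum_mono2[OF fin sub]) auto
  qed (auto intro: sum_nonneg)
  finally show ?thesis by (simp only: sum_binomial_det_squares of_nat_power mult.commute)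
qed

text \<open>
  Sorting a row is a permutation of its entries, hence of the rows of its determinant.
\<close>

lemma injective_row_sorted:
  assumes f: "f \<in> PiE {..n} (\<lambda>_. {..<L})" and inj: "inj_on f {..n}"
  obtains l p where "l \<in> strict_rows n L" "p permutes {..n}" "\<And>i. i \<le> n \<Longrightarrow> f i = l (p i)"
proof -
  define S where "S = sorted_list_of_set (f ` {..n})"
  have len: "length S = Suc n" by (simp add: S_def card_image[OF inj])
  have strict: "sorted_wrt (<) S" and set: "set S = f ` {..n}"
    by (simp_all add: S_def)
  define l where "l = restrict (nth S) {..n}"
  have "l \<in> strict_rows n L"
  proof -
    have "S ! i < L" if "i \<le> n" for i
      using f nth_mem[of i S] that unfolding set len by (auto simp: PiE_iff)
    moreover have "S ! i < S ! Suc i" if "i < n" for i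
      using strict that len by (auto simp: sorted_wrt_iff_nth_less)
    ultimately show ?thesis by (auto simp: strict_rows_def l_def)
  qed
  define p where "p i = (if i \<le> n then (THE k. k \<le> n \<and> S ! k = f i) else i)" for i
  have "distinct S" by (simp add: S_def)
  have p: "p i \<le> n \<and> S ! p i = f i" if "i \<le> n" for i
  proof -
    have "f i \<in> set S" using that set by auto
    then obtain k where k: "k \<le> n" "S ! k = f i" using len by (auto simp: in_set_conv_nth less_Suc_eq_le)
    have "k' = k" if "k' \<le> n \<and> S ! k' = f i" for k'
      using nth_eq_iff_index_eq[OF \<open>distinct S\<close>, of k' k] that k len by simp
    then have "(THE k. k \<le> n \<and> S ! k = f i) = k"
      using k by (intro the_equality) blast+
    then show ?thesis using that k by (simp add: p_def)
  qed
  have "p permutes {..n}"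
  proof (rule bij_imp_permutes)
    have "inj_on p {..n}"
      using p inj by (metis atMost_iff inj_on_def)
    moreover have "p ` {..n} \<subseteq> {..n}" using p by auto
    ultimately show "bij_betw p {..n} {..n}"
      by (simp add: bij_betw_def endo_inj_surj)
  qed (auto simp: p_def)
  moreover have "f i = l (p i)" if "i \<le> n" for i using p[OF that] by (simp add: l_def)
  ultimately show ?thesis using that \<open>l \<in> strict_rows n L\<close> by blast
qed

text \<open>
  The determinant of a row with a repeated entry vanishes; any other row can be sorted, and then the
  determinant is, up to sign, one of the terms that \<open>gt_total\<close> adds up.
\<close>

lemma abs_binomial_det_le_gt_total:
  assumes f: "f \<in> PiE {..n} (\<lambda>_. {..<L})"
  shows "\<bar>binomial_det (Suc n) f\<bar> \<le> real (gt_total n L)"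
proof (cases "inj_on f {..n}")
  case True
  obtain l p where l: "l \<in> strict_rows n L" and p: "p permutes {..n}" "\<And>i. i \<le> n \<Longrightarrow> f i = l (p i)"
    using injective_row_sorted[OF f True] by metis
  have "binomial_det (Suc n) f = det (mat (Suc n) (Suc n) (\<lambda>(i, j). real (l (p i) choose j)))"
    unfolding binomial_det_def using p(2) by (intro arg_cong[where f = det] eq_matI) (auto simp: less_Suc_eq_le)
  also have "\<dots> = signof p * binomial_det (Suc n) l"
    using p(1) unfolding binomial_det_def by (intro det_mat_permutes) (simp add: lessThan_Suc_atMost)
  finally have "\<bar>binomial_det (Suc n) f\<bar> = \<bar>binomial_det (Suc n) l\<bar>"
    by (simp add: abs_mult sign_def)
  also have "\<dots> = real (gt_count n l)" by (simp add: binomial_det_strict_row[OF l])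
  also have "\<dots> \<le> real (gt_total n L)"
    unfolding gt_total_def of_nat_le_iff by (rule member_le_sum[OF l]) (auto simp: finite_strict_rows)
  finally show ?thesis .
next
  case False
  then obtain i j where "i \<le> n" "j \<le> n" "i \<noteq> j" "f i = f j" by (auto simp: inj_on_def)
  then have "binomial_det (Suc n) f = 0" unfolding binomial_det_def
    by (intro det_identical_rows[of _ "Suc n" i j]) (auto intro!: eq_vecI)
  then show ?thesis by simp
qed

lemma det_gram_binomial_le:
  "fact (Suc n) * det (gram_binomial L (Suc n)) \<le> real L ^ Suc n * (real (gt_total n L))\<^sup>2"
proof -
  let ?F = "PiE {..n} (\<lambda>_. {..<L})"
  have "(\<Sum>f\<in>?F. (binomial_det (Suc n) f)\<^sup>2) \<le> (\<Sum>f\<in>?F. (real (gt_total n L))\<^sup>2)"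
    using abs_binomial_det_le_gt_total by (intro sum_mono) (simp add: abs_le_square_iff[symmetric])
  then show ?thesis by (simp add: sum_binomial_det_squares card_PiE)
qed

section \<open>Asymptotics of the Gram determinant\<close>

lemma stolz_cesaro:
  fixes a b :: "nat \<Rightarrow> real"
  assumes mono: "strict_mono b" and unbounded: "filterlim b at_top sequentially"
    and lim: "(\<lambda>n. (a (Suc n) - a n) / (b (Suc n) - b n)) \<longlonglongrightarrow> l"
  shows "(\<lambda>n. a n / b n) \<longlonglongrightarrow> l"
proof -
  define c where "c n = a n - l * b n" for n
  have pos: "b (Suc n) - b n > 0" for n using mono by (simp add: strict_mono_Suc_iff)
  have "(\<lambda>n. c n / b n) \<longlonglongrightarrow> 0"
  proof (rule LIMSEQ_I)
    fix e :: real assume "e > 0"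
    then obtain n0 where n0: "\<And>n. n \<ge> n0 \<Longrightarrow> \<bar>(a (Suc n) - a n) / (b (Suc n) - b n) - l\<bar> < e / 2"
      using LIMSEQ_D[OF lim, of "e / 2"] by auto
    have increment: "\<bar>c (Suc n) - c n\<bar> \<le> e / 2 * (b (Suc n) - b n)" if "n \<ge> n0" for n
    proof -
      have "c (Suc n) - c n = ((a (Suc n) - a n) / (b (Suc n) - b n) - l) * (b (Suc n) - b n)"
        using pos[of n] by (simp add: c_def field_simps)
      then show ?thesis using n0[OF that] pos[of n] by (simp add: abs_mult)
    qed
    have bound: "\<bar>c n\<bar> \<le> \<bar>c n0\<bar> + e / 2 * (b n - b n0)" if "n \<ge> n0" for n
      using that
    proof (induction n rule: dec_induct)
      case (step n)
      have "\<bar>c (Suc n)\<bar> \<le> \<bar>c n\<bar> + \<bar>c (Suc n) - c n\<bar>" by linarith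
      then show ?case using increment[of n] step unfolding right_diff_distrib by linarith
    qed simp
    have "eventually (\<lambda>n. b n > max 0 (2 / e * (\<bar>c n0\<bar> - e / 2 * b n0))) sequentially"
      using unbounded by (simp only: filterlim_at_top_dense)
    then have "eventually (\<lambda>n. \<bar>c n / b n\<bar> < e) sequentially"
      using eventually_ge_at_top[of n0]
    proof eventually_elim
      case (elim n)
      then have b: "b n > 0" "e / 2 * b n > \<bar>c n0\<bar> - e / 2 * b n0"
        using \<open>e > 0\<close> by (simp_all add: field_simps)
      have "\<bar>c n\<bar> < e * b n"
        using bound[OF elim(2)] b(2) unfolding right_diff_distrib by linarith
      then show ?case using b(1) by (simp add: field_simps)
    qed
    then show "\<exists>no. \<forall>n\<ge>no. norm (c n / b n - 0) < e"
      by (simp add: eventually_sequentially)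
  qed
  then have "(\<lambda>n. l + c n / b n) \<longlonglongrightarrow> l + 0" by (intro tendsto_intros)
  moreover have "eventually (\<lambda>n. l + c n / b n = a n / b n) sequentially"
  proof -
    have "eventually (\<lambda>n. b n > 0) sequentially"
      using unbounded by (simp only: filterlim_at_top_dense)
    then show ?thesis by eventually_elim (simp add: c_def field_simps)
  qed
  ultimately show ?thesis by (simp add: tendsto_cong)
qed

text \<open>
  Two applications of Stolz-Cesaro, first against \<open>n\<close> and then against \<open>n\<^sup>2\<close>. Compared with Stirling's
  formula, this only needs the limit of an elementary function.
\<close>

lemma second_difference_limit:
  fixes a :: "nat \<Rightarrow> real"
  assumes "(\<lambda>n. (a (n + 2) - a (n + 1)) - (a (n + 1) - a n)) \<longlonglongrightarrow> c"
  shows "(\<lambda>n. a n / real n ^ 2) \<longlonglongrightarrow> c / 2"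
proof (rule stolz_cesaro)
  have "(\<lambda>n. (a (n + 1) - a n) / real n) \<longlonglongrightarrow> c"
    using assms by (intro stolz_cesaro[of real]) (simp_all add: strict_mono_def filterlim_real_sequentially)
  moreover have "(\<lambda>n. real n / (2 * real n + 1)) \<longlonglongrightarrow> 1 / 2" by real_asymp
  ultimately have "(\<lambda>n. (a (n + 1) - a n) / real n * (real n / (2 * real n + 1))) \<longlonglongrightarrow> c * (1 / 2)"
    by (rule tendsto_mult)
  moreover have "eventually (\<lambda>n. (a (n + 1) - a n) / real n * (real n / (2 * real n + 1)) =
       (a (Suc n) - a n) / (real (Suc n) ^ 2 - real n ^ 2)) sequentially"
    using eventually_gt_at_top[of 0]
  proof eventually_elim
    case (elim n)
    have "real (Suc n) ^ 2 - real n ^ 2 = 2 * real n + 1" by (simp add: power2_eq_square algebra_simps)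
    then show ?case using elim by (simp del: of_nat_Suc)
  qed
  ultimately have "(\<lambda>n. (a (Suc n) - a n) / (real (Suc n) ^ 2 - real n ^ 2)) \<longlonglongrightarrow> c * (1 / 2)"
    by (rule Lim_transform_eventually)
  then show "(\<lambda>n. (a (Suc n) - a n) / (real (Suc n) ^ 2 - real n ^ 2)) \<longlonglongrightarrow> c / 2" by simp
  show "strict_mono (\<lambda>n. real n ^ 2)" by (auto simp: strict_mono_Suc_iff power2_eq_square algebra_simps)
  show "filterlim (\<lambda>n. real n ^ 2) at_top sequentially" by real_asymp
qed

definition superfact :: "nat \<Rightarrow> real" where
  "superfact k = (\<Prod>j<k. fact j)"

lemma superfact_pos: "superfact k > 0" by (simp add: superfact_def prod_pos)

lemma superfact_Suc: "superfact (Suc k) = superfact k * fact k" by (simp add: superfact_def)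

lemma superfact_add: "superfact (a + b) = superfact a * (\<Prod>n<b. fact (a + n))"
  by (induction b) (simp_all add: superfact_Suc)

text \<open>
  MacMahon's number of plane partitions in an \<open>N \<times> N \<times> N\<close> box. In the product formula the factorials of
  \<open>2 N + n\<close>, of \<open>2 N - 1 - n\<close>, and of \<open>2 n\<close> and \<open>2 n + 1\<close> each run through an interval.
\<close>

lemma det_gram_binomial_superfact:
  "det (gram_binomial (2 * N) N) = superfact (3 * N) * superfact N ^ 3 / superfact (2 * N) ^ 3"
proof -
  have even_odd: "(\<Prod>n<M. fact (2 * n) * fact (2 * n + 1)) = superfact (2 * M)" for M
    by (induction M) (simp_all add: superfact_Suc, simp add: superfact_def)
  have "(\<Prod>n<N. fact (2 * N - 1 - n)) = (\<Prod>n<N. fact (N + n) :: real)"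
    by (subst prod.nat_diff_reindex[symmetric]) (auto intro!: prod.cong arg_cong[where f = fact])
  then have rev: "superfact N * (\<Prod>n<N. fact (2 * N - 1 - n)) = superfact (2 * N)"
    using superfact_add[of N N] by (simp add: mult_2)
  have A: "(\<Prod>n<N. real ((2 * N + n) choose (2 * n + 1))) * (\<Prod>n<N. fact (2 * n + 1)) * (\<Prod>n<N. fact (2 * N - 1 - n))
     = (\<Prod>n<N. fact (2 * N + n))"
    unfolding prod.distrib[symmetric]
  proof (intro prod.cong refl)
    fix n assume "n \<in> {..<N}"
    then have "2 * n + 1 \<le> 2 * N + n" "2 * N + n - (2 * n + 1) = 2 * N - 1 - n" by auto
    then show "real ((2 * N + n) choose (2 * n + 1)) * fact (2 * n + 1) * fact (2 * N - 1 - n) = fact (2 * N + n)"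
      by (simp add: binomial_fact)
  qed
  have B: "(\<Prod>n<N. real ((2 * n) choose n)) * superfact N ^ 2 = (\<Prod>n<N. fact (2 * n))"
    unfolding superfact_def power2_eq_square prod.distrib[symmetric]
    by (intro prod.cong refl) (simp add: binomial_fact mult_2)
  have nz: "(\<Prod>n<N. real ((2 * n) choose n)) > 0" by (intro prod_pos) auto
  let ?D = "det (gram_binomial (2 * N) N)" and ?P = "\<Prod>n<N. real ((2 * n) choose n)"
    and ?O = "\<Prod>n<N. fact (2 * n + 1) :: real" and ?R = "\<Prod>n<N. fact (2 * N - 1 - n) :: real"
  have main: "?D * ?P * ?O * ?R * superfact (2 * N) = superfact (3 * N)"
    using superfact_add[of "2 * N" N] unfolding det_gram_binomial A by (simp add: mult.commute)
  have PO: "?P * superfact N ^ 2 * ?O = superfact (2 * N)"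
    unfolding B prod.distrib[symmetric] by (rule even_odd)
  have "superfact (3 * N) * superfact N ^ 3 =
    ?D * (?P * superfact N ^ 2 * ?O) * (superfact N * ?R) * superfact (2 * N)"
    unfolding main[symmetric] by (simp add: power2_eq_square power3_eq_cube)
  also have "\<dots> = ?D * superfact (2 * N) ^ 3"
    unfolding PO rev by (simp add: power3_eq_cube)
  finally show ?thesis using superfact_pos[of "2 * N"] by (simp add: field_simps)
qed

lemma det_gram_binomial_pos: "det (gram_binomial (2 * N) N) > 0"
  by (simp add: det_gram_binomial_superfact superfact_pos)

text \<open>
  In the second difference of \<open>ln D\<^sub>N\<close> all factorials cancel down to finitely many linear factors.
\<close>

lemma ln_det_gram_binomial_limit:
  "(\<lambda>N. ln (det (gram_binomial (2 * N) N)) / real N ^ 2) \<longlonglongrightarrow> (9 * ln 3 - 12 * ln 2) / 2"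
proof (rule second_difference_limit)
  define F where "F k = ln (superfact k)" for k
  have F_Suc: "F (Suc k) = F k + ln (fact k)" for k
    by (simp add: F_def superfact_Suc superfact_pos ln_mult_pos)
  have fact_Suc': "ln (fact (Suc k)) = ln (fact k :: real) + ln (real k + 1)" for k
    by (simp add: ln_mult_pos add.commute del: of_nat_Suc)
  have D: "ln (det (gram_binomial (2 * N) N)) = F (3 * N) - 3 * F (2 * N) + 3 * F N" for N
    using superfact_pos[of "3 * N"] superfact_pos[of "2 * N"] superfact_pos[of N]
    by (simp add: det_gram_binomial_superfact F_def ln_div ln_mult_pos ln_realpow)
  define e where "e N = (ln (3 * real N + 1) + ln (3 * real N + 2) + ln (3 * real N + 3)) +
     (ln (3 * real N + 2) + ln (3 * real N + 3) + ln (3 * real N + 4)) +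
     (ln (3 * real N + 3) + ln (3 * real N + 4) + ln (3 * real N + 5)) -
     3 * (ln (2 * real N + 1) + 2 * ln (2 * real N + 2) + ln (2 * real N + 3)) + 3 * ln (real N + 1)" for N :: nat
  have "(ln (det (gram_binomial (2 * (N + 2)) (N + 2))) - ln (det (gram_binomial (2 * (N + 1)) (N + 1)))) -
     (ln (det (gram_binomial (2 * (N + 1)) (N + 1))) - ln (det (gram_binomial (2 * N) N))) = e N" for N
  proof -
    have "3 * (N + 2) = Suc (Suc (Suc (Suc (Suc (Suc (3 * N))))))" "3 * (N + 1) = Suc (Suc (Suc (3 * N)))"
      "2 * (N + 2) = Suc (Suc (Suc (Suc (2 * N))))" "2 * (N + 1) = Suc (Suc (2 * N))"
      "N + 2 = Suc (Suc N)" "N + 1 = Suc N" by simp_all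
    then show ?thesis
      unfolding D by (simp only: F_Suc fact_Suc') (simp add: e_def algebra_simps)
  qed
  moreover have "e \<longlonglongrightarrow> 9 * ln 3 - 12 * ln 2" unfolding e_def by real_asymp
  ultimately show "(\<lambda>n. (ln (det (gram_binomial (2 * (n + 2)) (n + 2))) - ln (det (gram_binomial (2 * (n + 1)) (n + 1)))) -
     (ln (det (gram_binomial (2 * (n + 1)) (n + 1))) - ln (det (gram_binomial (2 * n) n)))) \<longlonglongrightarrow> 9 * ln 3 - 12 * ln 2"
    by simp
qed


text \<open>
  The two squeezing inequalities in logarithmic form. Both \<open>N!\<close> and \<open>(2 N)\<^sup>N\<close> only contribute
  an error of order \<open>N ln N\<close>.
\<close>

lemma gt_total_bounds:
  fixes n :: nat
  defines "N \<equiv> Suc n"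
  shows "gt_total n (2 * N) > 0"
    and "\<bar>2 * ln (real (gt_total n (2 * N))) - ln (det (gram_binomial (2 * N) N))\<bar> \<le> 2 * (real N * ln (2 * real N))"
proof -
  let ?S = "real (gt_total n (2 * N))" and ?D = "det (gram_binomial (2 * N) N)"
  have D: "?D > 0" by (rule det_gram_binomial_pos)
  have up: "?S\<^sup>2 \<le> (2 * real N) ^ N * (fact N * ?D)"
    using gt_total_square_le[of n "2 * N"] by (simp add: N_def)
  have low: "fact N * ?D \<le> (2 * real N) ^ N * ?S\<^sup>2"
    using det_gram_binomial_le[of n "2 * N"] by (simp add: N_def)
  have "fact N * ?D > 0" using D by simp
  with low have "(2 * real N) ^ N * ?S\<^sup>2 > 0" by linarith
  then have S: "?S > 0" by (simp add: zero_less_mult_iff)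
  then show "gt_total n (2 * N) > 0" by simp
  have NN: "2 * real N > 0" by (simp add: N_def)
  have f1: "1 \<le> (fact N :: real)" by (simp add: fact_ge_1)
  have "(fact N :: real) \<le> real (N ^ N)" by (rule fact_le_power)
  also have "\<dots> \<le> (2 * real N) ^ N" unfolding of_nat_power by (rule power_mono) auto
  finally have f2: "ln (fact N :: real) \<le> real N * ln (2 * real N)"
    using NN by (simp flip: ln_realpow)
  have "2 * ln ?S \<le> real N * ln (2 * real N) + (ln (fact N) + ln ?D)"
  proof -
    have "ln (?S\<^sup>2) \<le> ln ((2 * real N) ^ N * (fact N * ?D))"
      using up S D NN by (intro ln_mono) auto
    also have "\<dots> = real N * ln (2 * real N) + (ln (fact N) + ln ?D)"
      using NN D by (simp add: ln_mult_pos ln_realpow distrib_left)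
    finally show ?thesis using S by (simp add: ln_realpow)
  qed
  moreover have "ln (fact N) + ln ?D \<le> real N * ln (2 * real N) + 2 * ln ?S"
  proof -
    have "ln (fact N * ?D) \<le> ln ((2 * real N) ^ N * ?S\<^sup>2)"
      using low S D NN by (intro ln_mono) auto
    also have "\<dots> = real N * ln (2 * real N) + 2 * ln ?S"
      using NN S by (simp add: ln_mult_pos ln_realpow distrib_left)
    finally show ?thesis using D by (simp add: ln_mult_pos)
  qed
  moreover have "ln (fact N :: real) \<ge> 0" using f1 by simp
  ultimately show "\<bar>2 * ln ?S - ln ?D\<bar> \<le> 2 * (real N * ln (2 * real N))"
    using f2 by linarith
qed

lemma ln_gt_total_limit:
  "(\<lambda>m. ln (real (gt_total (m - 2) (2 * (m - 1)))) / real m ^ 2) \<longlonglongrightarrow> (9 * ln 3 - 12 * ln 2) / 4"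
proof -
  define S where "S n = ln (real (gt_total n (2 * Suc n)))" for n
  define D where "D N = ln (det (gram_binomial (2 * N) N))" for N
  have D: "(\<lambda>n. D (Suc n) / real (Suc n) ^ 2) \<longlonglongrightarrow> (9 * ln 3 - 12 * ln 2) / 2"
    using ln_det_gram_binomial_limit unfolding D_def by (rule LIMSEQ_Suc)
  have "(\<lambda>n. (2 * S n - D (Suc n)) / real (Suc n) ^ 2) \<longlonglongrightarrow> 0"
  proof (rule tendsto_0_le[where K = 1])
    show "eventually (\<lambda>n. norm ((2 * S n - D (Suc n)) / real (Suc n) ^ 2) \<le>
             norm (2 * (real (Suc n) * ln (2 * real (Suc n))) / real (Suc n) ^ 2) * 1) sequentially"
    proof (intro always_eventually allI)
      fix n
      have "\<bar>2 * S n - D (Suc n)\<bar> \<le> \<bar>2 * (real (Suc n) * ln (2 * real (Suc n)))\<bar>"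
        using gt_total_bounds(2)[of n] unfolding S_def D_def by (rule order_trans[OF _ abs_ge_self])
      then show "norm ((2 * S n - D (Suc n)) / real (Suc n) ^ 2) \<le>
          norm (2 * (real (Suc n) * ln (2 * real (Suc n))) / real (Suc n) ^ 2) * 1"
        by (simp only: real_norm_def abs_divide mult_1_right) (rule divide_right_mono, auto)
    qed
    show "(\<lambda>n. 2 * (real (Suc n) * ln (2 * real (Suc n))) / real (Suc n) ^ 2) \<longlonglongrightarrow> 0" by real_asymp
  qed
  from tendsto_add[OF this D] have "(\<lambda>n. 2 * S n / real (Suc n) ^ 2) \<longlonglongrightarrow> (9 * ln 3 - 12 * ln 2) / 2"
    by (simp add: diff_divide_distrib)
  \<comment> \<open>Rows of length \<open>N = n + 1\<close> belong to \<open>m = n + 2\<close>, so \<open>N\<^sup>2\<close> is replaced by \<open>m\<^sup>2\<close>.\<close>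
  moreover have "(\<lambda>n. real (Suc n) ^ 2 / real (n + 2) ^ 2 / 2) \<longlonglongrightarrow> 1 / 2" by real_asymp
  ultimately have "(\<lambda>n. 2 * S n / real (Suc n) ^ 2 * (real (Suc n) ^ 2 / real (n + 2) ^ 2 / 2))
     \<longlonglongrightarrow> (9 * ln 3 - 12 * ln 2) / 2 * (1 / 2)" by (rule tendsto_mult)
  then have "(\<lambda>n. S n / real (n + 2) ^ 2) \<longlonglongrightarrow> (9 * ln 3 - 12 * ln 2) / 4"
    by (simp del: of_nat_Suc of_nat_add)
  then show ?thesis
    unfolding S_def by - (rule LIMSEQ_offset[where k = 2], simp)
qed

section \<open>Monotone path systems as patterns\<close>

lemma J_edges_iff:
  "{u, v} \<in> J_edges m \<longleftrightarrow>
     u \<in> J_verts m \<and> v \<in> J_verts m \<and> u \<noteq> v \<and> \<not> (\<exists>i j. u = X i \<and> v = X j)"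
  unfolding J_edges_def by (auto simp: doubleton_eq_iff)

lemma X_in_J_verts [simp]: "X i \<in> J_verts m \<longleftrightarrow> 1 \<le> i \<and> i \<le> m"
  and Y_in_J_verts [simp]: "Y i \<in> J_verts m \<longleftrightarrow> 1 \<le> i \<and> i \<le> m"
  by (auto simp: J_verts_def)

lemma path_of_mem:
  assumes "path_system V E P" "u \<in> V" "v \<in> V" "u \<noteq> v"
  shows "path_of P u v \<in> P"
proof -
  have "\<exists>!p. p \<in> P \<and> hd p = u \<and> last p = v" using assms by (auto simp: path_system_def)
  from theI'[OF this] show ?thesis unfolding path_of_def by simp
qed

lemma path_of_eq:
  assumes "path_system V E P" "p \<in> P"
  shows "path_of P (hd p) (last p) = p"
proof -
  have p: "p \<noteq> []" "set p \<subseteq> V" "hd p \<noteq> last p"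
    using assms by (auto simp: path_system_def simple_path_def)
  then have "hd p \<in> V" "last p \<in> V" by auto
  then have "\<exists>!q. q \<in> P \<and> hd q = hd p \<and> last q = last p"
    using assms p by (auto simp: path_system_def)
  then show ?thesis unfolding path_of_def using assms(2) by (intro the1_equality) auto
qed

definition monotone_matrix :: "nat \<Rightarrow> (nat \<Rightarrow> nat \<Rightarrow> nat) \<Rightarrow> bool" where
  "monotone_matrix m M \<longleftrightarrow>
     (\<forall>i\<in>{1..m}. \<forall>j\<in>{1..m}. i \<noteq> j \<longrightarrow> M i j \<in> {1..m} \<and> M i j = M j i) \<and>
     (\<forall>i\<in>{1..m}. \<forall>j\<in>{1..m}. \<forall>k\<in>{1..m}. j \<le> k \<and> j \<noteq> i \<and> k \<noteq> i \<longrightarrow> M i j \<le> M i k)"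

lemma monotone_matrix_rangeD:
  assumes "monotone_matrix m M" "i \<in> {1..m}" "j \<in> {1..m}" "i \<noteq> j"
  shows "M i j \<in> {1..m}" "M i j = M j i"
  using assms unfolding monotone_matrix_def by simp_all

definition matrix_paths :: "nat \<Rightarrow> (nat \<Rightarrow> nat \<Rightarrow> nat) \<Rightarrow> jvertex list set" where
  "matrix_paths m M = {[u, v] | u v. {u, v} \<in> J_edges m} \<union>
     {[X i, Y (M i j), X j] | i j. i \<in> {1..m} \<and> j \<in> {1..m} \<and> i \<noteq> j}"

lemma edge_in_matrix_paths: "{u, v} \<in> J_edges m \<Longrightarrow> [u, v] \<in> matrix_paths m M"
  by (simp add: matrix_paths_def)

lemma cherry_in_matrix_paths:
  "i \<in> {1..m} \<Longrightarrow> j \<in> {1..m} \<Longrightarrow> i \<noteq> j \<Longrightarrow> [X i, Y (M i j), X j] \<in> matrix_paths m M"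
  by (simp add: matrix_paths_def)

lemma matrix_paths_cases [consumes 1, case_names edge cherry]:
  assumes "p \<in> matrix_paths m M"
  obtains u v where "p = [u, v]" "{u, v} \<in> J_edges m"
    | i j where "p = [X i, Y (M i j), X j]" "i \<in> {1..m}" "j \<in> {1..m}" "i \<noteq> j"
  using assms unfolding matrix_paths_def by (elim UnE CollectE exE conjE)

text \<open>
  A path system is recovered from its path between each pair of vertices, and a monotone one prescribes all of them:
  an edge for adjacent vertices, a path through \<open>y\<close> with index \<open>m\<^sub>i\<^sub>j\<close> for the others.
\<close>

lemma monotone_path_system_imp_matrix_paths:
  assumes "monotone_path_system m P"
  obtains M where "monotone_matrix m M" "P = matrix_paths m M"
proof -
  have P: "path_system (J_verts m) (J_edges m) P" "neighborly (J_edges m) P"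
    using assms by (simp_all add: monotone_path_system_def)
  obtain M where entries: "\<forall>i\<in>{1..m}. \<forall>j\<in>{1..m}. i \<noteq> j \<longrightarrow>
        M i j \<in> {1..m} \<and> M i j = M j i \<and> path_of P (X i) (X j) = [X i, Y (M i j), X j]"
    and rows: "\<forall>i\<in>{1..m}. \<forall>j\<in>{1..m}. \<forall>k\<in>{1..m}. j \<le> k \<and> j \<noteq> i \<and> k \<noteq> i \<longrightarrow> M i j \<le> M i k"
    using assms unfolding monotone_path_system_def by (elim conjE exE)
  have M: "monotone_matrix m M"
    unfolding monotone_matrix_def using rows entries by simp
  have paths: "path_of P (X i) (X j) = [X i, Y (M i j), X j]"
    if "i \<in> {1..m}" "j \<in> {1..m}" "i \<noteq> j" for i j
    using entries that by simp
  have edge_path: "path_of P u v = [u, v]" if "{u, v} \<in> J_edges m" for u v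
    using P(2) that by (auto simp: neighborly_def)
  have "P = matrix_paths m M"
  proof (intro equalityI subsetI)
    fix p assume "p \<in> P"
    then have p: "path_of P (hd p) (last p) = p" "p \<noteq> []" "set p \<subseteq> J_verts m" "hd p \<noteq> last p"
      using P(1) path_of_eq by (auto simp: path_system_def simple_path_def)
    then have V: "hd p \<in> J_verts m" "last p \<in> J_verts m" by auto
    show "p \<in> matrix_paths m M"
    proof (cases "{hd p, last p} \<in> J_edges m")
      case True
      then have "[hd p, last p] \<in> matrix_paths m M" by (rule edge_in_matrix_paths)
      then show ?thesis using edge_path[OF True] p(1) by argo
    next
      case False
      then obtain i j where ij: "hd p = X i" "last p = X j" using V p(4) unfolding J_edges_iff by auto
      then have range: "i \<in> {1..m}" "j \<in> {1..m}" "i \<noteq> j" using V p(4) by auto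
      then have "[X i, Y (M i j), X j] \<in> matrix_paths m M" by (rule cherry_in_matrix_paths)
      then show ?thesis using paths[OF range] p(1) unfolding ij by argo
    qed
  next
    fix p assume "p \<in> matrix_paths m M"
    then show "p \<in> P"
    proof (cases rule: matrix_paths_cases)
      case (edge u v)
      then show ?thesis using edge_path[of u v] path_of_mem[OF P(1), of u v] by (auto simp: J_edges_iff)
    next
      case (cherry i j)
      then show ?thesis using paths[of i j] path_of_mem[OF P(1), of "X i" "X j"] by auto
    qed
  qed
  with M show ?thesis by (rule that)
qed

lemma path_of_matrix_paths:
  assumes "p \<in> matrix_paths m M"
  shows "path_of (matrix_paths m M) (hd p) (last p) = p"
proof -
  have "q = p" if q: "q \<in> matrix_paths m M" "hd q = hd p" "last q = last p" for q
    using q(1)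
  proof (cases rule: matrix_paths_cases)
    case (edge u v)
    with assms q show ?thesis by (cases rule: matrix_paths_cases) (simp_all add: J_edges_iff)
  next
    case (cherry i j)
    with assms q show ?thesis by (cases rule: matrix_paths_cases) (auto simp: J_edges_iff)
  qed
  then show ?thesis unfolding path_of_def using assms by (intro the_equality) blast+
qed

lemma matrix_paths_path_system:
  assumes M: "monotone_matrix m M"
  shows "path_system (J_verts m) (J_edges m) (matrix_paths m M)"
  unfolding path_system_def
proof (intro conjI ballI impI)
  fix p assume p: "p \<in> matrix_paths m M"
  from p have "simple_path (J_verts m) (J_edges m) p \<and> hd p \<noteq> last p \<and> rev p \<in> matrix_paths m M"
  proof (cases rule: matrix_paths_cases)
    case (edge u v)
    then have "{v, u} \<in> J_edges m" by (simp add: insert_commute)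
    then have "rev p \<in> matrix_paths m M" using edge_in_matrix_paths[of v u] edge(1) by simp
    with edge show ?thesis by (simp add: simple_path_def J_edges_iff)
  next
    case (cherry i j)
    note range = monotone_matrix_rangeD[OF M cherry(2-4)]
    have "[X j, Y (M j i), X i] \<in> matrix_paths m M" using cherry(2-4) by (intro cherry_in_matrix_paths) simp_all
    then have "rev p \<in> matrix_paths m M" using cherry(1) range(2) by simp
    with cherry range show ?thesis by (simp add: simple_path_def J_edges_iff)
  qed
  then show "simple_path (J_verts m) (J_edges m) p" "hd p \<noteq> last p" "rev p \<in> matrix_paths m M" by auto
next
  fix u v assume uv: "u \<in> J_verts m" "v \<in> J_verts m" "u \<noteq> v"
  have "\<exists>p\<in>matrix_paths m M. hd p = u \<and> last p = v"
  proof (cases "{u, v} \<in> J_edges m")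
    case True
    then have "[u, v] \<in> matrix_paths m M" by (rule edge_in_matrix_paths)
    then show ?thesis by (rule rev_bexI) simp
  next
    case False
    then obtain i j where ij: "u = X i" "v = X j" using uv unfolding J_edges_iff by auto
    then have "i \<in> {1..m}" "j \<in> {1..m}" "i \<noteq> j" using uv by simp_all
    then have "[X i, Y (M i j), X j] \<in> matrix_paths m M" by (rule cherry_in_matrix_paths)
    then show ?thesis unfolding ij by (rule rev_bexI) simp
  qed
  then obtain p where p: "p \<in> matrix_paths m M" "hd p = u" "last p = v" by blast
  have "q = p" if "q \<in> matrix_paths m M \<and> hd q = u \<and> last q = v" for q
    using path_of_matrix_paths[of q m M] path_of_matrix_paths[of p m M] that p by simp
  then show "\<exists>!p. p \<in> matrix_paths m M \<and> hd p = u \<and> last p = v"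
    using p by (intro ex1I[of _ p]) blast+
qed

lemma monotone_path_system_matrix_paths:
  assumes M: "monotone_matrix m M"
  shows "monotone_path_system m (matrix_paths m M)"
proof -
  have "neighborly (J_edges m) (matrix_paths m M)"
    unfolding neighborly_def
  proof (intro allI impI)
    fix u v assume "{u, v} \<in> J_edges m"
    then have "[u, v] \<in> matrix_paths m M" by (rule edge_in_matrix_paths)
    from path_of_matrix_paths[OF this] show "path_of (matrix_paths m M) u v = [u, v]" by simp
  qed
  moreover have "path_of (matrix_paths m M) (X i) (X j) = [X i, Y (M i j), X j]"
    if "i \<in> {1..m}" "j \<in> {1..m}" "i \<noteq> j" for i j
  proof -
    have "[X i, Y (M i j), X j] \<in> matrix_paths m M" using that by (rule cherry_in_matrix_paths)
    from path_of_matrix_paths[OF this] show ?thesis by simp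
  qed
  then have "\<forall>i\<in>{1..m}. \<forall>j\<in>{1..m}. i \<noteq> j \<longrightarrow> M i j \<in> {1..m} \<and> M i j = M j i \<and>
      path_of (matrix_paths m M) (X i) (X j) = [X i, Y (M i j), X j]"
    using monotone_matrix_rangeD[OF M] by (intro ballI impI conjI)
  ultimately show ?thesis
    using matrix_paths_path_system[OF M] M[unfolded monotone_matrix_def, THEN conjunct2]
    unfolding monotone_path_system_def by (intro conjI exI[of _ M])
qed

lemma monotone_path_systems_eq:
  "{P. monotone_path_system m P} = matrix_paths m ` {M. monotone_matrix m M}"
proof (intro equalityI subsetI)
  fix P assume "P \<in> {P. monotone_path_system m P}"
  then obtain M where "monotone_matrix m M" "P = matrix_paths m M"
    using monotone_path_system_imp_matrix_paths by auto
  then show "P \<in> matrix_paths m ` {M. monotone_matrix m M}" by simp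
next
  fix P assume "P \<in> matrix_paths m ` {M. monotone_matrix m M}"
  then obtain M where "monotone_matrix m M" "P = matrix_paths m M" by (elim imageE CollectE)
  then show "P \<in> {P. monotone_path_system m P}" using monotone_path_system_matrix_paths by simp
qed

lemma matrix_paths_cong:
  assumes "\<And>i j. i \<in> {1..m} \<Longrightarrow> j \<in> {1..m} \<Longrightarrow> i \<noteq> j \<Longrightarrow> M i j = M' i j"
  shows "matrix_paths m M = matrix_paths m M'"
proof (intro equalityI subsetI)
  fix p assume "p \<in> matrix_paths m M"
  then show "p \<in> matrix_paths m M'"
  proof (cases rule: matrix_paths_cases)
    case (cherry i j)
    then show ?thesis using cherry_in_matrix_paths[of i m j M'] assms[of i j] by simp
  qed (simp add: edge_in_matrix_paths)
next
  fix p assume "p \<in> matrix_paths m M'"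
  then show "p \<in> matrix_paths m M"
  proof (cases rule: matrix_paths_cases)
    case (cherry i j)
    then show ?thesis using cherry_in_matrix_paths[of i m j M] assms[of i j] by simp
  qed (simp add: edge_in_matrix_paths)
qed

text \<open>
  Together with the previous lemma: monotone path systems correspond to monotone matrices, up to the
  values of the matrix on the diagonal and outside the index range, which carry no information.
\<close>

lemma matrix_paths_eqD:
  assumes "matrix_paths m M = matrix_paths m M'" "i \<in> {1..m}" "j \<in> {1..m}" "i \<noteq> j"
  shows "M i j = M' i j"
proof -
  have "[X i, Y (M i j), X j] \<in> matrix_paths m M'"
    using cherry_in_matrix_paths[OF assms(2-4), of M] assms(1) by simp
  then show ?thesis by (cases rule: matrix_paths_cases) simp_all
qed

text \<open>
  The row of index \<open>k\<close> of a pattern has the entries with \<open>i \<le> n - k\<close>. All other values are fixed to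
  \<open>undefined\<close>, so that distinct patterns are distinct functions and patterns can be counted.
\<close>

definition gt_patterns :: "nat \<Rightarrow> (nat \<Rightarrow> nat) \<Rightarrow> (nat \<Rightarrow> nat \<Rightarrow> nat) set" where
  "gt_patterns n l = {t. t 0 = l \<and>
     (\<forall>k i. k + i < n \<longrightarrow> t k i \<le> t (Suc k) i \<and> t (Suc k) i < t k (Suc i)) \<and>
     (\<forall>k. t k \<in> extensional {i. k + i \<le> n})}"

text \<open>
  Removing the first row \<open>l\<close> leaves a smaller pattern, whose own first row may be any row interlacing with \<open>l\<close>. This is
  the recursion of \<open>gt_count\<close>.
\<close>

lemma gt_patterns_Suc:
  assumes "l \<in> extensional {..Suc n}"
  shows "gt_patterns (Suc n) l = (\<Union>\<mu>\<in>PiE {..n} (\<lambda>i. {l i..<l (Suc i)}). case_nat l ` gt_patterns n \<mu>)"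
    (is "?L = ?R")
proof (intro equalityI subsetI)
  fix t assume t: "t \<in> ?L"
  then have "t = case_nat l (\<lambda>k. t (Suc k))"
    by (auto simp: gt_patterns_def fun_eq_iff split: nat.split)
  moreover have inter: "t k i \<le> t (Suc k) i \<and> t (Suc k) i < t k (Suc i)" if "k + i \<le> n" for k i
    using t that unfolding gt_patterns_def by auto
  have ext: "t (Suc k) \<in> extensional {i. k + i \<le> n}" for k
    using t unfolding gt_patterns_def by (auto dest: spec[of _ "Suc k"])
  have "(\<lambda>k. t (Suc k)) \<in> gt_patterns n (t 1)"
    using t ext by (auto simp: gt_patterns_def)
  moreover have "t 1 \<in> PiE {..n} (\<lambda>i. {l i..<l (Suc i)})"
    using inter[of 0] ext[of 0] t by (auto simp: PiE_iff gt_patterns_def extensional_def)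
  ultimately show "t \<in> ?R" by blast
next
  fix t assume "t \<in> ?R"
  then obtain \<mu> s where \<mu>: "\<mu> \<in> PiE {..n} (\<lambda>i. {l i..<l (Suc i)})" and s: "s \<in> gt_patterns n \<mu>"
    and t: "t = case_nat l s" by blast
  have "t k i \<le> t (Suc k) i \<and> t (Suc k) i < t k (Suc i)" if "k + i < Suc n" for k i
  proof (cases k)
    case 0
    then have "i \<in> {..n}" using that by simp
    then have "\<mu> i \<in> {l i..<l (Suc i)}" using \<mu> by (rule PiE_mem[rotated])
    then show ?thesis using 0 s t by (auto simp: gt_patterns_def)
  next
    case (Suc k')
    then show ?thesis using s t that by (auto simp: gt_patterns_def)
  qed
  moreover have "t k \<in> extensional {i. k + i \<le> Suc n}" for k
    using s t assms by (auto simp: gt_patterns_def extensional_def split: nat.split)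
  ultimately show "t \<in> ?L" by (auto simp: gt_patterns_def t)
qed

lemma card_gt_patterns:
  assumes "l \<in> extensional {..n}"
  shows "finite (gt_patterns n l) \<and> card (gt_patterns n l) = gt_count n l"
  using assms
proof (induction n arbitrary: l)
  case 0
  have "gt_patterns 0 l = {case_nat l (\<lambda>_ _. undefined)}"
  proof (intro equalityI subsetI)
    fix t assume t: "t \<in> gt_patterns 0 l"
    then have "t (Suc k) = (\<lambda>_. undefined)" for k
      by (auto simp: gt_patterns_def extensional_def dest: spec[of _ "Suc k"])
    with t show "t \<in> {case_nat l (\<lambda>_ _. undefined)}"
      by (auto simp: gt_patterns_def fun_eq_iff split: nat.split)
  qed (use 0 in \<open>auto simp: gt_patterns_def extensional_def split: nat.split\<close>)
  then show ?case by simp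
next
  case (Suc n)
  let ?I = "PiE {..n} (\<lambda>i. {l i..<l (Suc i)})"
  have IH: "finite (gt_patterns n \<mu>)" "card (gt_patterns n \<mu>) = gt_count n \<mu>" if "\<mu> \<in> ?I" for \<mu>
    using Suc.IH[of \<mu>] that by (auto simp: PiE_iff)
  \<comment> \<open>\<open>case_nat l\<close> puts the row \<open>l\<close> in front of a pattern.\<close>
  have inj: "inj (case_nat l)"
  proof (rule injI)
    fix s s' :: "nat \<Rightarrow> nat \<Rightarrow> nat" assume "case_nat l s = case_nat l s'"
    from fun_cong[OF this, of "Suc k" for k] show "s = s'" by auto
  qed
  have "finite ?I" by (auto intro: finite_PiE)
  moreover have "case_nat l ` gt_patterns n \<mu> \<inter> case_nat l ` gt_patterns n \<nu> = {}" if "\<mu> \<noteq> \<nu>" for \<mu> \<nu>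
    using that inj by (auto simp: gt_patterns_def dest: injD)
  ultimately have "card (gt_patterns (Suc n) l) = (\<Sum>\<mu>\<in>?I. card (case_nat l ` gt_patterns n \<mu>))"
    unfolding gt_patterns_Suc[OF Suc.prems] by (intro card_UN_disjoint) (auto simp: IH)
  also have "\<dots> = gt_count (Suc n) l"
    using inj by (simp add: card_image inj_on_subset IH)
  finally show ?case
    unfolding gt_patterns_Suc[OF Suc.prems] using \<open>finite ?I\<close> IH by auto
qed

definition all_patterns :: "nat \<Rightarrow> nat \<Rightarrow> (nat \<Rightarrow> nat \<Rightarrow> nat) set" where
  "all_patterns n L = (\<Union>l\<in>strict_rows n L. gt_patterns n l)"

lemma card_all_patterns: "card (all_patterns n L) = gt_total n L"
proof -
  have ext: "l \<in> extensional {..n}" if "l \<in> strict_rows n L" for l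
    using that by (auto simp: strict_rows_def PiE_iff)
  show ?thesis
    unfolding all_patterns_def gt_total_def
    by (subst card_UN_disjoint) (auto simp: finite_strict_rows card_gt_patterns ext, auto simp: gt_patterns_def)
qed

text \<open>
  The entry \<open>i\<close> of row \<open>k\<close> belongs to the position with the one-based indices \<open>i + 1\<close> and \<open>i + k + 2\<close>: the rows of a pattern
  are the diagonals above the main diagonal. Subtracting \<open>i\<close> undoes the shift that makes the
  rows strictly increasing, and \<open>Suc\<close> moves the values from \<open>{0, \<dots>, m - 1}\<close> to \<open>{1, \<dots>, m}\<close>.
\<close>

definition pattern_matrix :: "(nat \<Rightarrow> nat \<Rightarrow> nat) \<Rightarrow> nat \<Rightarrow> nat \<Rightarrow> nat" where
  "pattern_matrix t i j = (let a = min i j; b = max i j in Suc (t (b - a - 1) (a - 1) - (a - 1)))"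

lemma pattern_matrix_commute: "pattern_matrix t i j = pattern_matrix t j i"
  by (simp add: pattern_matrix_def min.commute max.commute)

lemma pattern_matrix_entry: "pattern_matrix t (Suc i) (Suc (Suc (k + i))) = Suc (t k i - i)"
  by (simp add: pattern_matrix_def Let_def)

text \<open>
  The strict inequalities \<open>t\<^sub>k(i) < t\<^sub>k(i + 1)\<close> force \<open>t\<^sub>k(i) \<ge> i\<close>. Dually, the last entry of the first row
  is at most \<open>2 n + 1\<close>, so the first row is bounded by \<open>n + 1 + i\<close>, and this bound passes down along interlacing.
\<close>

lemma all_patterns_bounds:
  assumes t: "t \<in> all_patterns n (2 * Suc n)" and ki: "k + i \<le> n"
  shows "i \<le> t k i" "t k i \<le> Suc n + i"
proof -
  have inter: "t k i \<le> t (Suc k) i \<and> t (Suc k) i < t k (Suc i)" if "k + i < n" for k i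
    using t that by (auto simp: all_patterns_def gt_patterns_def)
  have row: "t 0 \<in> strict_rows n (2 * Suc n)"
    using t by (auto simp: all_patterns_def gt_patterns_def)
  show "i \<le> t k i" using ki
  proof (induction i)
    case (Suc i)
    then show ?case using inter[of k i] by simp
  qed simp
  \<comment> \<open>Induction from the last entry of the first row backwards.\<close>
  have top: "t 0 (n - d) \<le> Suc n + (n - d)" if "d \<le> n" for d
    using that
  proof (induction d)
    case 0
    have "t 0 n < 2 * Suc n" using row by (auto simp: strict_rows_def PiE_iff)
    then show ?case by simp
  next
    case (Suc d)
    then have "t 0 (n - Suc d) < t 0 (Suc (n - Suc d))" using row by (auto simp: strict_rows_def)
    moreover have "Suc (n - Suc d) = n - d" using Suc.prems by simp
    ultimately show ?case using Suc by simp
  qed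
  show "t k i \<le> Suc n + i" using ki
  proof (induction k arbitrary: i)
    case 0
    then show ?case using top[of "n - i"] by simp
  next
    case (Suc k)
    then show ?case using inter[of k i] Suc.IH[of "Suc i"] by simp
  qed
qed

text \<open>
  The two interlacing inequalities say that the triangle increases to the right and downwards. A full
  row of the symmetric matrix runs down a column to the diagonal and then turns right; the two parts fit
  together since \<open>m\<^sub>j\<^sub>i \<le> m\<^sub>j\<^sub>k \<le> m\<^sub>i\<^sub>k\<close> for \<open>j < i < k\<close>.
\<close>

lemma monotone_pattern_matrix:
  assumes t: "t \<in> all_patterns n (2 * Suc n)"
  shows "monotone_matrix (n + 2) (pattern_matrix t)"
proof -
  let ?A = "pattern_matrix t"
  have inter: "t k i \<le> t (Suc k) i \<and> t (Suc k) i < t k (Suc i)" if "k + i < n" for k i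
    using t that by (auto simp: all_patterns_def gt_patterns_def)
  have range: "?A a b \<in> {1..n + 2}" if "1 \<le> a" "a < b" "b \<le> n + 2" for a b
  proof -
    define k i where "k = b - a - 1" and "i = a - 1"
    have k: "a = Suc i" "b = Suc (Suc (k + i))" "k + i \<le> n" using that by (auto simp: k_def i_def)
    show ?thesis
      using all_patterns_bounds(2)[OF t k(3)] pattern_matrix_entry[of t i k] k by (simp add: le_diff_conv)
  qed
  have right: "?A a b \<le> ?A a b'" if "1 \<le> a" "a < b" "b \<le> b'" "b' \<le> n + 2" for a b b'
    using \<open>b \<le> b'\<close> \<open>b' \<le> n + 2\<close>
  proof (induction b' rule: dec_induct)
    case (step c)
    define k i where "k = c - a - 1" and "i = a - 1"
    have k: "a = Suc i" "c = Suc (Suc (k + i))" "Suc c = Suc (Suc (Suc k + i))" "k + i < n"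
      using step.hyps step.prems that(1,2) by (auto simp: k_def i_def)
    have "?A a c = Suc (t k i - i)" using pattern_matrix_entry[of t i k] k by simp
    moreover have "?A a (Suc c) = Suc (t (Suc k) i - i)" using pattern_matrix_entry[of t i "Suc k"] k by simp
    ultimately have "?A a c \<le> ?A a (Suc c)" using inter[OF k(4)] by auto
    then show ?case using step by simp
  qed simp
  have down: "?A a b \<le> ?A a' b" if "1 \<le> a" "a \<le> a'" "a' < b" "b \<le> n + 2" for a a' b
    using \<open>a \<le> a'\<close> \<open>a' < b\<close>
  proof (induction a' rule: dec_induct)
    case (step c)
    define k where "k = b - c - 2"
    define i where "i = c - 1"
    have k: "c = Suc i" "b = Suc (Suc (Suc k + i))" "b = Suc (Suc (k + Suc i))" "k + i < n"
      using step that by (auto simp: k_def i_def)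
    have "?A c b = Suc (t (Suc k) i - i)" using pattern_matrix_entry[of t i "Suc k"] k by simp
    moreover have "?A (Suc c) b = Suc (t k (Suc i) - Suc i)" using pattern_matrix_entry[of t "Suc i" k] k by simp
    ultimately have "?A c b \<le> ?A (Suc c) b" using inter[OF k(4)] by auto
    then show ?case using step by simp
  qed simp
  show ?thesis unfolding monotone_matrix_def
  proof (intro conjI ballI impI)
    fix i j assume "i \<in> {1..n + 2}" "j \<in> {1..n + 2}" "i \<noteq> j"
    then show "?A i j \<in> {1..n + 2}" "?A i j = ?A j i"
      using range[of i j] range[of j i] pattern_matrix_commute[of t i j] by (cases "i < j"; simp)+
  next
    fix i j k assume ijk: "i \<in> {1..n + 2}" "j \<in> {1..n + 2}" "k \<in> {1..n + 2}" "j \<le> k \<and> j \<noteq> i \<and> k \<noteq> i"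
    then consider "i < j" | "j < i" "i < k" | "k < i" by linarith
    then show "?A i j \<le> ?A i k"
    proof cases
      case 1
      then show ?thesis using right[of i j k] ijk by auto
    next
      case 2
      then show ?thesis using right[of j i k] down[of j i k] ijk pattern_matrix_commute[of t i j] by auto
    next
      case 3
      then show ?thesis using down[of j k i] ijk pattern_matrix_commute[of t i j] pattern_matrix_commute[of t i k] by auto
    qed
  qed
qed

lemma monotone_matrix_pattern:
  assumes M: "monotone_matrix (n + 2) M"
  shows "\<exists>t\<in>all_patterns n (2 * Suc n). \<forall>i\<in>{1..n + 2}. \<forall>j\<in>{1..n + 2}. i \<noteq> j \<longrightarrow> pattern_matrix t i j = M i j"
proof -
  have range: "M i j \<in> {1..n + 2}" "M i j = M j i" if "i \<in> {1..n + 2}" "j \<in> {1..n + 2}" "i \<noteq> j" for i j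
    using M that unfolding monotone_matrix_def by blast+
  have mono: "M i j \<le> M i k" if "i \<in> {1..n + 2}" "j \<in> {1..n + 2}" "k \<in> {1..n + 2}" "j \<le> k" "j \<noteq> i" "k \<noteq> i" for i j k
    using M that unfolding monotone_matrix_def by blast
  define t where "t k i = (if k + i \<le> n then M (Suc i) (Suc (Suc (k + i))) - 1 + i else undefined)" for k i
  have inter: "t k i \<le> t (Suc k) i \<and> t (Suc k) i < t k (Suc i)" if ki: "k + i < n" for k i
  proof
    have "M (Suc i) (Suc (Suc (k + i))) \<le> M (Suc i) (Suc (Suc (Suc k + i)))"
      using ki by (intro mono) auto
    then show "t k i \<le> t (Suc k) i" using ki by (auto simp: t_def)
    have "M (Suc i) (Suc (Suc (Suc k + i))) = M (Suc (Suc (Suc k + i))) (Suc i)"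
      using ki by (intro range) auto
    also have "\<dots> \<le> M (Suc (Suc (Suc k + i))) (Suc (Suc i))"
      using ki by (intro mono) auto
    also have "\<dots> = M (Suc (Suc i)) (Suc (Suc (k + Suc i)))"
      using ki by (subst range(2)) auto
    finally show "t (Suc k) i < t k (Suc i)" using ki by (auto simp: t_def)
  qed
  have "t 0 i < 2 * Suc n" if "i \<le> n" for i
    using range(1)[of "Suc i" "Suc (Suc i)"] that by (auto simp: t_def)
  moreover have "t 0 i < t 0 (Suc i)" if "i < n" for i
    using inter[of 0 i] that by simp
  moreover have ext: "t k \<in> extensional {i. k + i \<le> n}" for k by (auto simp: t_def extensional_def)
  ultimately have "t 0 \<in> strict_rows n (2 * Suc n)"
    using ext[of 0] by (auto simp: strict_rows_def PiE_iff atMost_def)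
  then have t: "t \<in> all_patterns n (2 * Suc n)"
    unfolding all_patterns_def gt_patterns_def using inter ext by auto
  have less: "pattern_matrix t a b = M a b" if "1 \<le> a" "a < b" "b \<le> n + 2" for a b
  proof -
    define k i where "k = b - a - 1" and "i = a - 1"
    have k: "a = Suc i" "b = Suc (Suc (k + i))" "k + i \<le> n" using that by (auto simp: k_def i_def)
    then show ?thesis
      using pattern_matrix_entry[of t i k] range(1)[of a b] that by (auto simp: t_def)
  qed
  have "pattern_matrix t i j = M i j" if "i \<in> {1..n + 2}" "j \<in> {1..n + 2}" "i \<noteq> j" for i j
    using less[of i j] less[of j i] that range(2)[of i j] pattern_matrix_commute[of t i j]
    by (cases "i < j") auto
  with t show ?thesis by blast
qed

lemma card_monotone_path_systems:
  "card {P. monotone_path_system (n + 2) P} = gt_total n (2 * Suc n)"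
proof -
  let ?T = "all_patterns n (2 * Suc n)" and ?F = "\<lambda>t. matrix_paths (n + 2) (pattern_matrix t)"
  have "{P. monotone_path_system (n + 2) P} = ?F ` ?T"
  proof (intro equalityI subsetI)
    fix P assume "P \<in> {P. monotone_path_system (n + 2) P}"
    then obtain M where M: "monotone_matrix (n + 2) M" "P = matrix_paths (n + 2) M"
      unfolding monotone_path_systems_eq by blast
    from monotone_matrix_pattern[OF M(1)] obtain t where t: "t \<in> ?T"
      "\<And>i j. i \<in> {1..n + 2} \<Longrightarrow> j \<in> {1..n + 2} \<Longrightarrow> i \<noteq> j \<Longrightarrow> pattern_matrix t i j = M i j" by blast
    have "?F t = P" unfolding M(2) by (rule matrix_paths_cong) (rule t(2))
    with t(1) show "P \<in> ?F ` ?T" by blast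
  qed (use monotone_pattern_matrix monotone_path_system_matrix_paths in blast)
  moreover have "inj_on ?F ?T"
  proof (rule inj_onI)
    fix t s assume t: "t \<in> ?T" and s: "s \<in> ?T" and eq: "?F t = ?F s"
    have "t k i = s k i" for k i
    proof (cases "k + i \<le> n")
      case True
      then have "Suc i \<in> {1..n + 2}" "Suc (Suc (k + i)) \<in> {1..n + 2}" "Suc i \<noteq> Suc (Suc (k + i))" by auto
      from matrix_paths_eqD[OF eq this] have "t k i - i = s k i - i"
        by (simp add: pattern_matrix_entry)
      then show ?thesis using all_patterns_bounds(1)[OF t True] all_patterns_bounds(1)[OF s True] by simp
    next
      case False
      then have "i \<notin> {i. k + i \<le> n}" by simp
      moreover have "t k \<in> extensional {i. k + i \<le> n}" "s k \<in> extensional {i. k + i \<le> n}"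
        using t s by (auto simp: all_patterns_def gt_patterns_def)
      ultimately show ?thesis unfolding extensional_def by simp
    qed
    then show "t = s" by blast
  qed
  ultimately show ?thesis by (simp add: card_image card_all_patterns)
qed

section \<open>Metric realization of monotone path systems\<close>

text \<open>
  A down-set of pairs is a threshold graph. If the first vertex is joined to the last one, it is joined to all; then it gets a
  weight larger than all others together. Otherwise the last vertex is isolated and gets a
  very negative weight. In both cases the remaining vertices are handled by induction.
\<close>

lemma threshold_weights:
  fixes E :: "nat \<Rightarrow> nat \<Rightarrow> bool"
  assumes "\<And>i j i' j'. a \<le> i' \<Longrightarrow> i' \<le> i \<Longrightarrow> j' \<le> j \<Longrightarrow> j < b \<Longrightarrow> i < j \<Longrightarrow> i' < j' \<Longrightarrow> E i j \<Longrightarrow> E i' j'"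
  shows "\<exists>d :: nat \<Rightarrow> real. \<forall>i j. a \<le> i \<and> i < j \<and> j < b \<longrightarrow> (if E i j then d i + d j > 0 else d i + d j < 0)"
  using assms
proof (induction "b - a" arbitrary: a b)
  case 0
  then show ?case by (intro exI[of _ "\<lambda>_. 0"]) auto
next
  case (Suc n)
  define c where "c = b - 1"
  have b: "b = Suc c" "a \<le> c" using Suc.hyps(2) by (auto simp: c_def)
  show ?case
  proof (cases "a < c \<and> E a c")
    case True
    obtain d :: "nat \<Rightarrow> real" where
      d: "\<And>i j. Suc a \<le> i \<Longrightarrow> i < j \<Longrightarrow> j < b \<Longrightarrow> (if E i j then d i + d j > 0 else d i + d j < 0)"
    proof -
      have "n = b - Suc a" using Suc.hyps(2) by simp
      then have "\<exists>d :: nat \<Rightarrow> real. \<forall>i j. Suc a \<le> i \<and> i < j \<and> j < b \<longrightarrow>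
          (if E i j then d i + d j > 0 else d i + d j < 0)"
      proof (rule Suc.hyps(1))
        fix i j i' j' assume "Suc a \<le> i'" "i' \<le> i" "j' \<le> j" "j < b" "i < j" "i' < j'" "E i j"
        then show "E i' j'" using Suc.prems[of i' i j' j] by simp
      qed
      then show ?thesis using that by blast
    qed
    have big: "\<bar>d j\<bar> \<le> (\<Sum>i<b. \<bar>d i\<bar>)" if "j < b" for j
      using that by (intro member_le_sum) auto
    have "if E i j then (d(a := 1 + (\<Sum>i<b. \<bar>d i\<bar>))) i + (d(a := 1 + (\<Sum>i<b. \<bar>d i\<bar>))) j > 0
          else (d(a := 1 + (\<Sum>i<b. \<bar>d i\<bar>))) i + (d(a := 1 + (\<Sum>i<b. \<bar>d i\<bar>))) j < 0"
      if ij: "a \<le> i" "i < j" "j < b" for i j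
    proof (cases "i = a")
      case [simp]: True
      have "E a j" using Suc.prems[of a a j c] \<open>a < c \<and> E a c\<close> ij b by simp
      then show ?thesis using ij big[of j] by auto
    next
      case False
      then show ?thesis using ij d[of i j] by auto
    qed
    then show ?thesis by blast
  next
    case False
    obtain d :: "nat \<Rightarrow> real" where
      d: "\<And>i j. a \<le> i \<Longrightarrow> i < j \<Longrightarrow> j < c \<Longrightarrow> (if E i j then d i + d j > 0 else d i + d j < 0)"
    proof -
      have "n = c - a" using Suc.hyps(2) b by simp
      have "\<exists>d :: nat \<Rightarrow> real. \<forall>i j. a \<le> i \<and> i < j \<and> j < c \<longrightarrow> (if E i j then d i + d j > 0 else d i + d j < 0)"
        using \<open>n = c - a\<close>
      proof (rule Suc.hyps(1))
        fix i j i' j' assume "a \<le> i'" "i' \<le> i" "j' \<le> j" "j < c" "i < j" "i' < j'" "E i j"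
        then show "E i' j'" using Suc.prems[of i' i j' j] b by simp
      qed
      then show ?thesis using that by blast
    qed
    have big: "\<bar>d j\<bar> \<le> (\<Sum>i<b. \<bar>d i\<bar>)" if "j < b" for j
      using that by (intro member_le_sum) auto
    have "if E i j then (d(c := - (1 + (\<Sum>i<b. \<bar>d i\<bar>)))) i + (d(c := - (1 + (\<Sum>i<b. \<bar>d i\<bar>)))) j > 0
          else (d(c := - (1 + (\<Sum>i<b. \<bar>d i\<bar>)))) i + (d(c := - (1 + (\<Sum>i<b. \<bar>d i\<bar>)))) j < 0"
      if ij: "a \<le> i" "i < j" "j < b" for i j
    proof (cases "j = c")
      case [simp]: True
      have "\<not> E i c" using Suc.prems[of a i c c] False ij b by auto
      then show ?thesis using ij big[of i] by auto
    next
      case False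
      then show ?thesis using ij d[of i j] b by auto
    qed
    then show ?thesis by blast
  qed
qed

lemma monotone_matrix_mono:
  assumes "monotone_matrix m M" "i \<in> {1..m}" "j \<in> {1..m}" "k \<in> {1..m}" "j \<le> k" "j \<noteq> i" "k \<noteq> i"
  shows "M i j \<le> M i k"
  using assms unfolding monotone_matrix_def by simp

lemma monotone_matrix_mono_pair:
  assumes M: "monotone_matrix m M" and "1 \<le> i'" "i' \<le> i" "j' \<le> j" "j \<le> m" "i < j" "i' < j'"
  shows "M i' j' \<le> M i j"
proof -
  have "M i' j' \<le> M i' j" using assms by (intro monotone_matrix_mono[OF M]) auto
  also have "\<dots> = M j i'" using assms by (intro monotone_matrix_rangeD[OF M]) auto
  also have "\<dots> \<le> M j i" using assms by (intro monotone_matrix_mono[OF M]) auto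
  also have "\<dots> = M i j" using assms by (intro monotone_matrix_rangeD[OF M]) auto
  finally show ?thesis .
qed

lemma valley_minimum:
  fixes e :: "nat \<Rightarrow> real"
  assumes "\<And>x. a \<le> x \<Longrightarrow> x < M \<Longrightarrow> e x < 0" "\<And>x. M \<le> x \<Longrightarrow> x < b \<Longrightarrow> e x > 0"
    and "a \<le> k" "k \<le> b" "a \<le> M" "k \<noteq> M"
  shows "sum e {a..<M} < sum e {a..<k}"
proof (cases "k < M")
  case True
  have "sum e {a..<k} + sum e {k..<M} = sum e {a..<M}"
    using True assms by (intro sum.atLeastLessThan_concat) auto
  moreover have "sum e {k..<M} < sum (\<lambda>_. 0) {k..<M}"
    using True assms by (intro sum_strict_mono) auto
  ultimately show ?thesis by simp
next
  case False
  have "sum e {a..<M} + sum e {M..<k} = sum e {a..<k}"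
    using False assms by (intro sum.atLeastLessThan_concat) auto
  moreover have "sum (\<lambda>_. 0) {M..<k} < sum e {M..<k}"
    using False assms by (intro sum_strict_mono) auto
  ultimately show ?thesis by simp
qed

text \<open>
  The numbers \<open>s\<^sub>i(k)\<close> are partial sums over \<open>x < k\<close> of threshold weights of the down-sets \<open>{M i j \<le> x}\<close>. Hence
  \<open>s\<^sub>i(k) + s\<^sub>j(k)\<close> falls as long as \<open>k < M i j\<close> and rises from there on.
\<close>

lemma monotone_matrix_costs:
  assumes M: "monotone_matrix m M"
  obtains s :: "nat \<Rightarrow> nat \<Rightarrow> real" where
    "\<And>i j k. i \<in> {1..m} \<Longrightarrow> j \<in> {1..m} \<Longrightarrow> i \<noteq> j \<Longrightarrow> k \<in> {1..m} \<Longrightarrow> k \<noteq> M i j \<Longrightarrow>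
       s i (M i j) + s j (M i j) < s i k + s j k"
proof -
  have "\<exists>d :: nat \<Rightarrow> real. \<forall>i j. 1 \<le> i \<and> i < j \<and> j < Suc m \<longrightarrow>
        (if M i j \<le> k then d i + d j > 0 else d i + d j < 0)" for k
    by (rule threshold_weights) (use monotone_matrix_mono_pair[OF M] le_trans less_Suc_eq_le in blast)
  then obtain d :: "nat \<Rightarrow> nat \<Rightarrow> real" where d: "\<And>k i j. 1 \<le> i \<Longrightarrow> i < j \<Longrightarrow> j \<le> m \<Longrightarrow>
        (if M i j \<le> k then d k i + d k j > 0 else d k i + d k j < 0)"
    by (metis less_Suc_eq_le)
  define s where "s i k = (\<Sum>x\<in>{1..<k}. d x i)" for i k
  have less: "s i (M i j) + s j (M i j) < s i k + s j k"
    if "1 \<le> i" "i < j" "j \<le> m" "k \<in> {1..m}" "k \<noteq> M i j" for i j k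
    unfolding s_def sum.distrib[symmetric]
  proof (rule valley_minimum[where b = k])
    show "1 \<le> M i j" using monotone_matrix_rangeD(1)[OF M, of i j] that by simp
  next
    fix x assume "x < M i j"
    then show "d x i + d x j < 0" using d[OF that(1-3), of x] by simp
  next
    fix x assume "M i j \<le> x"
    then show "d x i + d x j > 0" using d[OF that(1-3), of x] by simp
  qed (use that in auto)
  show ?thesis
  proof (rule that)
    fix i j k assume *: "i \<in> {1..m}" "j \<in> {1..m}" "i \<noteq> j" "k \<in> {1..m}" "k \<noteq> M i j"
    show "s i (M i j) + s j (M i j) < s i k + s j k"
    proof (cases "i < j")
      case True
      then show ?thesis using less[of i j k] * by simp
    next
      case False
      then show ?thesis using less[of j i k] * monotone_matrix_rangeD(2)[OF M *(1-3)] by simp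
    qed
  qed
qed

lemma path_edges_subset: "e \<in> path_edges p \<Longrightarrow> e \<subseteq> set p"
  by (induction p rule: path_edges.induct) auto

lemma card_path_edges:
  "distinct p \<Longrightarrow> finite (path_edges p) \<and> card (path_edges p) = length p - 1"
proof (induction p rule: path_edges.induct)
  case (1 u v p)
  have "{u, v} \<notin> path_edges (v # p)" using path_edges_subset[of "{u, v}" "v # p"] 1 by auto
  then show ?case using 1 by simp
qed auto

text \<open>
  The weights are the costs \<open>s\<^sub>i(k)\<close> added to a constant \<open>10 B\<close>, where \<open>B\<close> exceeds the sum of all \<open>\<bar>s\<^sub>i(k)\<bar>\<close>.
  Every edge then weighs between \<open>9 B\<close> and \<open>11 B\<close>, so one edge is shorter than any two
  and two edges are shorter than any three, and the costs decide among the paths \<open>x\<^sub>i y\<^sub>k x\<^sub>j\<close>.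
\<close>

lemma strictly_metric_matrix_paths:
  assumes M: "monotone_matrix m M"
  shows "strictly_metric (J_verts m) (J_edges m) (matrix_paths m M)"
proof -
  obtain s :: "nat \<Rightarrow> nat \<Rightarrow> real" where
    s: "\<And>i j k. i \<in> {1..m} \<Longrightarrow> j \<in> {1..m} \<Longrightarrow> i \<noteq> j \<Longrightarrow> k \<in> {1..m} \<Longrightarrow> k \<noteq> M i j \<Longrightarrow>
       s i (M i j) + s j (M i j) < s i k + s j k"
    using monotone_matrix_costs[OF M] by auto
  let ?I = "{1..m} \<times> {1..m}"
  define B where "B = 1 + (\<Sum>(i, k)\<in>?I. \<bar>s i k\<bar>)"
  define w :: "jvertex set \<Rightarrow> real" where
    "w e = 10 * B + (\<Sum>(i, k)\<in>?I. if e = {X i, Y k} then s i k else 0)" for e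
  have B: "B > 0" unfolding B_def by (intro add_pos_nonneg sum_nonneg) auto
  have w_bounds: "9 * B < w e" "w e < 11 * B" for e
  proof -
    have "\<bar>\<Sum>(i, k)\<in>?I. if e = {X i, Y k} then s i k else 0\<bar> \<le> (\<Sum>(i, k)\<in>?I. \<bar>s i k\<bar>)"
      by (rule order_trans[OF sum_abs], rule sum_mono) auto
    then show "9 * B < w e" "w e < 11 * B" by (auto simp: w_def B_def)
  qed
  have w_XY: "w {X i, Y k} = 10 * B + s i k" if "i \<in> {1..m}" "k \<in> {1..m}" for i k
  proof -
    have "(\<Sum>(a, b)\<in>?I. if {X i, Y k} = {X a, Y b} then s a b else 0) =
          (\<Sum>z\<in>?I. if z = (i, k) then s i k else 0)"
      by (intro sum.cong) (auto simp: doubleton_eq_iff split: if_splits)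
    also have "\<dots> = s i k" using that by simp
    finally show ?thesis by (simp add: w_def)
  qed
  have long: "real (length q - 1) * (9 * B) \<le> sum w (path_edges q)" if "distinct q" for q
  proof -
    have "(\<Sum>e\<in>path_edges q. 9 * B) \<le> sum w (path_edges q)"
      using w_bounds(1) by (intro sum_mono) (simp add: less_imp_le)
    then show ?thesis using card_path_edges[OF that] by simp
  qed
  have "sum w (path_edges p) < sum w (path_edges q)"
    if p: "p \<in> matrix_paths m M" and q: "simple_path (J_verts m) (J_edges m) q" "hd q = hd p" "last q = last p" "q \<noteq> p"
    for p q
  proof -
    from q(1) have q': "q \<noteq> []" "distinct q" "set q \<subseteq> J_verts m" "path_edges q \<subseteq> J_edges m"
      by (auto simp: simple_path_def)
    from p show ?thesis
    proof (cases rule: matrix_paths_cases)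
      case (edge u v)
      then have "u \<noteq> v" by (simp add: J_edges_iff)
      have "length q \<ge> 3"
      proof (cases q rule: path_edges.cases)
        case (1 a b r)
        then show ?thesis using q edge \<open>u \<noteq> v\<close> by (cases r) auto
      qed (use q edge \<open>u \<noteq> v\<close> q' in auto)
      then have "2 * (9 * B) \<le> real (length q - 1) * (9 * B)" using B by (intro mult_right_mono) auto
      moreover have "sum w (path_edges p) < 11 * B" using w_bounds(2) by (simp add: edge)
      ultimately show ?thesis using long[OF q'(2)] B by linarith
    next
      case (cherry i j)
      have k: "M i j \<in> {1..m}" by (rule monotone_matrix_rangeD(1)[OF M cherry(2-4)])
      have w_cherry: "sum w (path_edges [X i, Y k, X j]) = (10 * B + s i k) + (10 * B + s j k)"
        if "k \<in> {1..m}" for k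
      proof -
        have "{X i, Y k} \<noteq> {Y k, X j}" using cherry(4) by (auto simp: doubleton_eq_iff)
        then show ?thesis
          using w_XY[OF cherry(2) that] w_XY[OF cherry(3) that] by (simp add: insert_commute)
      qed
      show ?thesis
      proof (cases "length q \<ge> 4")
        case True
        then have "3 * (9 * B) \<le> real (length q - 1) * (9 * B)" using B by (intro mult_right_mono) auto
        moreover have "sum w (path_edges p) < 22 * B"
          using w_bounds(2)[of "{X i, Y (M i j)}"] w_bounds(2)[of "{X j, Y (M i j)}"]
          unfolding cherry(1) w_cherry[OF k] w_XY[OF cherry(2) k] w_XY[OF cherry(3) k] by linarith
        ultimately show ?thesis using long[OF q'(2)] B by linarith
      next
        case False
        obtain b where b: "q = [X i, b, X j]" "{X i, b} \<in> J_edges m"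
        proof (cases q rule: path_edges.cases)
          case (1 a b r)
          show ?thesis
          proof (cases r)
            case Nil
            then have "{X i, X j} \<in> J_edges m" using 1 q q' cherry by simp
            then show ?thesis by (simp add: J_edges_iff)
          next
            case (Cons c r')
            then have "r' = []" using False 1 by (cases r') simp_all
            then show ?thesis using that[of b] 1 Cons q q' cherry by simp
          qed
        qed (use q cherry q' in auto)
        then obtain k' where k': "b = Y k'" "k' \<in> {1..m}"
          by (cases b) (auto simp: J_edges_iff)
        have "k' \<noteq> M i j" using q(4) b cherry(1) k' by auto
        then show ?thesis
          using s[OF cherry(2-4) k'(2)] unfolding b cherry(1) k'(1) w_cherry[OF k] w_cherry[OF k'(2)] by simp
      qed
    qed
  qed
  moreover have "\<forall>e\<in>J_edges m. w e > 0" using w_bounds(1) B by (smt (verit))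
  ultimately show ?thesis unfolding strictly_metric_def by (intro exI[of _ w] conjI ballI allI impI) auto
qed

text \<open>
  Two paths of length two that share exactly one end vertex \<open>x\<^sub>i\<close> meet in \<open>x\<^sub>i\<close> alone or, if they also share
  their middle vertex, in an edge.
\<close>

lemma cherry_Int_cherry:
  assumes "i \<noteq> j" "i \<noteq> c" "j \<noteq> c" and "{X i, Y k} \<in> J_edges m"
  shows "(\<exists>v. {X i, Y k, X j} \<inter> {X i, Y b, X c} = {v}) \<or>
         (\<exists>r\<in>matrix_paths m M. set r = {X i, Y k, X j} \<inter> {X i, Y b, X c} \<and>
            path_edges r = {{X i, Y k}, {X j, Y k}} \<inter> {{X i, Y b}, {X c, Y b}})"
proof (cases "k = b")
  case True
  have "[X i, Y k] \<in> matrix_paths m M" using assms(4) by (rule edge_in_matrix_paths)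
  moreover have "set [X i, Y k] = {X i, Y k, X j} \<inter> {X i, Y b, X c}" using True assms(1-3) by auto
  moreover have "path_edges [X i, Y k] = {{X i, Y k}, {X j, Y k}} \<inter> {{X i, Y b}, {X c, Y b}}"
    using True assms(1-3) by (auto simp: doubleton_eq_iff)
  ultimately show ?thesis by blast
next
  case False
  then have "{X i, Y k, X j} \<inter> {X i, Y b, X c} = {X i}" using assms(1-3) by auto
  then show ?thesis by blast
qed

text \<open>
  All paths have one or two edges. If an edge meets another path in both of its end vertices,
  it is an edge of that path, since the two \<open>x\<close>-vertices of a path of length two are not adjacent. For two paths of length
  two, the cases are distinguished by the end vertices that they share.
\<close>

lemma consistent_matrix_paths:
  assumes M: "monotone_matrix m M"
  shows "consistent_path_system (J_verts m) (J_edges m) (matrix_paths m M)"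
  unfolding consistent_path_system_def
proof (intro conjI ballI impI)
  show "path_system (J_verts m) (J_edges m) (matrix_paths m M)" by (rule matrix_paths_path_system[OF M])
  define good where "good p q \<longleftrightarrow> (\<exists>v. set p \<inter> set q = {v}) \<or>
        (\<exists>r\<in>matrix_paths m M. set r = set p \<inter> set q \<and> path_edges r = path_edges p \<inter> path_edges q)" for p q
  have good_commute: "good p q \<longleftrightarrow> good q p" for p q unfolding good_def by (simp add: Int_commute)
  have edge_good: "good [u, v] q"
    if uv: "{u, v} \<in> J_edges m" and q: "q \<in> matrix_paths m M" and ne: "set [u, v] \<inter> set q \<noteq> {}" for u v q
  proof (cases "{u, v} \<subseteq> set q")
    case True
    from q have "{u, v} \<in> path_edges q"
    proof (cases rule: matrix_paths_cases)
      case (edge a b)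
      then show ?thesis using True uv by (auto simp: J_edges_iff)
    next
      case (cherry i j)
      then show ?thesis using True uv by (auto simp: J_edges_iff)
    qed
    moreover have "[u, v] \<in> matrix_paths m M" using uv by (rule edge_in_matrix_paths)
    ultimately show ?thesis unfolding good_def using True by (intro disjI2 bexI[of _ "[u, v]"]) auto
  next
    case False
    then show ?thesis using ne unfolding good_def by auto
  qed
  fix p q assume p: "p \<in> matrix_paths m M" and q: "q \<in> matrix_paths m M" and ne: "set p \<inter> set q \<noteq> {}"
  from p have "good p q"
  proof (cases rule: matrix_paths_cases)
    case (edge u v)
    then show ?thesis using edge_good[OF edge(2) q] ne by simp
  next
    case p2: (cherry i j)
    from q show ?thesis
    proof (cases rule: matrix_paths_cases)
      case (edge u v)
      then show ?thesis using edge_good[OF edge(2) p] ne good_commute by (simp add: Int_commute)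
    next
      case q2: (cherry a c)
      define k b where "k = M i j" and "b = M a c"
      have sets: "set p = {X i, Y k, X j}" "set q = {X a, Y b, X c}"
        "path_edges p = {{X i, Y k}, {X j, Y k}}" "path_edges q = {{X a, Y b}, {X c, Y b}}"
        using p2 q2 by (simp_all add: k_def b_def insert_commute)
      have k: "k \<in> {1..m}" using monotone_matrix_rangeD[OF M p2(2-4)] by (simp add: k_def)
      then have edges: "{X i, Y k} \<in> J_edges m" "{X j, Y k} \<in> J_edges m"
        using p2 by (simp_all add: J_edges_iff)
      consider "i = a" "j = c" | "i = c" "j = a" | "i = a" "j \<noteq> c" | "i = c" "j \<noteq> a"
        | "j = a" "i \<noteq> c" | "j = c" "i \<noteq> a" | "i \<noteq> a" "i \<noteq> c" "j \<noteq> a" "j \<noteq> c"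
        by blast
      then show ?thesis
      proof cases
        case 1
        then have "p = q" using p2 q2 by simp
        then show ?thesis unfolding good_def using p by blast
      next
        case 2
        then have "k = b" using monotone_matrix_rangeD(2)[OF M p2(2-4)] by (simp add: k_def b_def)
        then have "set q = set p" "path_edges q = path_edges p" unfolding sets 2 by auto
        then show ?thesis unfolding good_def using p by (intro disjI2 bexI[of _ p]) auto
      next
        case 3
        then show ?thesis unfolding good_def sets
          using cherry_Int_cherry[of i j c k m b M] edges p2 q2 by simp
      next
        case 4
        then show ?thesis unfolding good_def sets
          using cherry_Int_cherry[of i j a k m b M] edges p2 q2 by (simp add: insert_commute)
      next
        case 5
        then show ?thesis unfolding good_def sets
          using cherry_Int_cherry[of j i c k m b M] edges p2 q2 by (simp add: insert_commute)
      next
        case 6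
        then show ?thesis unfolding good_def sets
          using cherry_Int_cherry[of j i a k m b M] edges p2 q2 by (simp add: insert_commute)
      next
        case 7
        then have "set p \<inter> set q = {Y k}" using ne unfolding sets by auto
        then show ?thesis unfolding good_def by blast
      qed
    qed
  qed
  then show "(\<exists>v. set p \<inter> set q = {v}) \<or>
        (\<exists>r\<in>matrix_paths m M. set r = set p \<inter> set q \<and> path_edges r = path_edges p \<inter> path_edges q)"
    unfolding good_def .
qed

lemma finite_NS:
  assumes "finite V"
  shows "finite (NS V E)"
proof (rule finite_subset)
  show "NS V E \<subseteq> Pow {p. set p \<subseteq> V \<and> distinct p}"
    unfolding NS_def consistent_path_system_def path_system_def simple_path_def by blast
  show "finite (Pow {p. set p \<subseteq> V \<and> distinct p})" using finite_subset_distinct[OF assms] by simp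
qed

lemma card_monotone_le_NS:
  "card {P. monotone_path_system m P} \<le> card (NS (J_verts m) (J_edges m))"
proof (rule card_mono)
  show "finite (NS (J_verts m) (J_edges m))" by (rule finite_NS) (simp add: J_verts_def)
  show "{P. monotone_path_system m P} \<subseteq> NS (J_verts m) (J_edges m)"
  proof
    fix P assume P: "P \<in> {P. monotone_path_system m P}"
    then obtain M where "monotone_matrix m M" "P = matrix_paths m M"
      using monotone_path_systems_eq by auto
    then show "P \<in> NS (J_verts m) (J_edges m)"
      using P strictly_metric_matrix_paths consistent_matrix_paths
      by (simp add: NS_def monotone_path_system_def)
  qed
qed

section \<open>The number of monotone path systems\<close>

text \<open>
  The bounds come from \<open>2\<^sup>1\<^sup>9 < 3\<^sup>1\<^sup>2\<close> and \<open>3\<^sup>4\<^sup>1 < 2\<^sup>6\<^sup>5\<close>, and determine \<open>\<alpha>\<close> to within \<open>0.001\<close>.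
\<close>

lemma log_2_3_bounds: "19 / 12 < log 2 3" "log 2 3 < 65 / 41"
proof -
  have "(2 :: real) ^ 19 < 3 ^ 12" "(3 :: real) ^ 41 < 2 ^ 65" by simp_all
  then have "ln ((2 :: real) ^ 19) < ln (3 ^ 12)" "ln ((3 :: real) ^ 41) < ln (2 ^ 65)"
    by (simp_all only: ln_less_cancel_iff zero_less_power zero_less_numeral)
  then have "19 * ln (2 :: real) < 12 * ln 3" "41 * ln (3 :: real) < 65 * ln 2"
    by (simp_all only: ln_realpow zero_less_numeral of_nat_numeral)
  then show "19 / 12 < log 2 3" "log 2 3 < 65 / 41"
    by (simp_all add: log_def field_simps)
qed

lemma ln_card_monotone_limit:
  "(\<lambda>m. ln (real (card {P. monotone_path_system m P})) / real m ^ 2) \<longlonglongrightarrow> (9 * ln 3 - 12 * ln 2) / 4"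
proof (rule Lim_transform_eventually[OF ln_gt_total_limit])
  show "eventually (\<lambda>m. ln (real (gt_total (m - 2) (2 * (m - 1)))) / real m ^ 2 =
      ln (real (card {P. monotone_path_system m P})) / real m ^ 2) sequentially"
    using eventually_ge_at_top[of 2]
  proof eventually_elim
    case (elim m)
    then obtain n where "m = n + 2" by (metis add.commute le_Suc_ex)
    then show ?case using card_monotone_path_systems[of n] by simp
  qed
qed

theorem proposition5p11:
  fixes \<alpha> :: real
  assumes "\<alpha> = 3 / 16 * (3 * log 2 3 - 4)"
  shows "\<bar>\<alpha> - 0.141\<bar> < 0.001 \<and>
         (\<exists>\<epsilon> :: nat \<Rightarrow> real. \<epsilon> \<longlonglongrightarrow> 0 \<and>
           (\<forall>\<^sub>F n in sequentially. even n \<longrightarrow>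
              real (card {P. monotone_path_system (n div 2) P})
                = 2 powr (\<alpha> * real n ^ 2 * (1 + \<epsilon> n)))) \<and>
         (\<exists>\<epsilon> :: nat \<Rightarrow> real. \<epsilon> \<longlonglongrightarrow> 0 \<and>
           (\<forall>\<^sub>F n in sequentially. even n \<longrightarrow>
              real (card (NS (J_verts (n div 2)) (J_edges (n div 2))))
                \<ge> 2 powr (\<alpha> * real n ^ 2 * (1 + \<epsilon> n))))"
proof -
  have numeric: "\<bar>\<alpha> - 0.141\<bar> < 0.001" and pos: "\<alpha> > 0"
    using log_2_3_bounds unfolding assms abs_less_iff by (simp_all add: field_simps)
  \<comment> \<open>The growth rate in base \<open>e\<close> relative to \<open>m\<^sup>2\<close>, where \<open>n = 2 m\<close>, hence the factor \<open>4\<close>.\<close>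
  define c where "c = 4 * \<alpha> * ln 2"
  have c: "c = (9 * ln 3 - 12 * ln 2) / 4" "c > 0"
    using pos by (simp_all add: c_def assms log_def field_simps)
  define f where "f m = ln (real (card {P. monotone_path_system m P})) / real m ^ 2" for m
  define \<epsilon> where "\<epsilon> n = (if even n then f (n div 2) / c - 1 else 0)" for n
  have "f \<longlonglongrightarrow> c" unfolding f_def c(1) by (rule ln_card_monotone_limit)
  moreover have "filterlim (\<lambda>n :: nat. n div 2) at_top sequentially"
    by (rule filterlim_at_top_div_const_nat) simp
  ultimately have "(\<lambda>n. f (n div 2)) \<longlonglongrightarrow> c" by (rule filterlim_compose)
  then have "(\<lambda>n. f (n div 2) / c - 1) \<longlonglongrightarrow> c / c - 1" using c(2) by (intro tendsto_intros) auto
  then have "(\<lambda>n. f (n div 2) / c - 1) \<longlonglongrightarrow> 0" using c(2) by simp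
  then have \<epsilon>: "\<epsilon> \<longlonglongrightarrow> 0"
    by (rule tendsto_0_le[where K = 1]) (simp add: \<epsilon>_def)
  have count: "eventually (\<lambda>n. even n \<longrightarrow> real (card {P. monotone_path_system (n div 2) P})
                = 2 powr (\<alpha> * real n ^ 2 * (1 + \<epsilon> n))) sequentially"
    using eventually_ge_at_top[of 4]
  proof eventually_elim
    case (elim n)
    show ?case
    proof
      assume "even n"
      then obtain m where m: "n = 2 * m" by blast
      define K where "K = real (card {P. monotone_path_system m P})"
      have "K > 0"
      proof -
        define k where "k = m - 2"
        have "m = k + 2" using elim m by (simp add: k_def)
        then show ?thesis using gt_total_bounds(1)[of k] card_monotone_path_systems[of k] by (simp add: K_def)
      qed
      have "\<alpha> * real n ^ 2 * (1 + \<epsilon> n) * ln 2 = c * real m ^ 2 * (f m / c)"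
        unfolding \<epsilon>_def m by (simp add: c_def power2_eq_square)
      also have "\<dots> = ln K" using c(2) elim m by (simp add: f_def K_def)
      finally have "2 powr (\<alpha> * real n ^ 2 * (1 + \<epsilon> n)) = K"
        using \<open>K > 0\<close> by (simp add: powr_def)
      then show "real (card {P. monotone_path_system (n div 2) P}) = 2 powr (\<alpha> * real n ^ 2 * (1 + \<epsilon> n))"
        by (simp add: K_def m)
    qed
  qed
  then have "eventually (\<lambda>n. even n \<longrightarrow> real (card (NS (J_verts (n div 2)) (J_edges (n div 2))))
                \<ge> 2 powr (\<alpha> * real n ^ 2 * (1 + \<epsilon> n))) sequentially"
  proof eventually_elim
    case (elim n)
    then show ?case using card_monotone_le_NS[of "n div 2"] by auto
  qed
  with numeric \<epsilon> count show ?thesis by (intro conjI exI[of _ \<epsilon>])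
qed

end
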